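(* Let $\Sigma$ be a strictly positive, self-adjoint trace class operator on $\mathcal{H}$ with eigenvalues $\lambda_1\ge\lambda_2\ge\dots>0$, let $\hat\Sigma$ be a positive self-adjoint compact operator on $\mathcal{H}$, and let $E=\hat\Sigma-\Sigma$. Let $\mathcal{I}\subseteq\mathbb{N}$ be finite. Suppose that there is a real number $x>0$ such that for all $i,j\ge 1$, $$\|P_iEP_j\|_2\le x\sqrt{\lambda_i\lambda_j}.$$ If $$\mathbf{r}_{\mathcal{I}}(\Sigma)\le \frac{1}{8x},$$ then $$\|\hat P_{\mathcal{I}}-P_{\mathcal{I}}\|_2^2\le 16x^2\sum_{i\in\mathcal{I}}\sum_{j\notin\mathcal{I}}\frac{\lambda_i\lambda_j}{(\lambda_i-\lambda_j)^2}.$$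
   Context: $\mathcal{H}$ is a separable Hilbert space and $p=\dim\mathcal{H}\in\mathbb{N}\cup\{\infty\}$; $\mathbb{N}=\{1,2,\dots\}$. If $p<\infty$, all indices and index sets are understood inside $\{1,\dots,p\}$, and complements are taken in $\{1,\dots,p\}$ (otherwise in $\mathbb{N}$). "Positive" operators are positive semi-definite; "strictly positive" means all eigenvalues are $>0$. The eigenvalues of $\Sigma$, counted with multiplicity, are $\lambda_1\ge\lambda_2\ge\cdots>0$, with corresponding eigenvectors $u_1,u_2,\dots$ forming an orthonormal basis of $\mathcal{H}$; the $\lambda_i$ are summable. The operator $\hat\Sigma$ has spectral decomposition $\hat\Sigma=\sum_{i\ge1}\hat\lambda_i\,\hat u_i\otimes\hat u_i$ with $\hat\lambda_1\ge\hat\lambda_2\ge\dots\ge 0$ its positive eigenvalues in nonincreasing order with multiplicity, and $\hat u_1,\hat u_2,\dots$ an orthonormal system of eigenvectors; if there are only finitely many positive eigenvalues, the sequence is extended by zeros, with corresponding orthonormal eigenvectors in the kernel (forming with the others an orthonormal basis if $p<\infty$). For a unit vector $u$, $u\otimes u$ is the orthogonal projection onto the span of $u$. $P_i=u_i\otimes u_i$, $\hat P_i=\hat u_i\otimes\hat u_i$, $P_{\mathcal{I}}=\sum_{i\in\mathcal{I}}P_i$, $\hat P_{\mathcal{I}}=\sum_{i\in\mathcal{I}}\hat P_i$. $\|\cdot\|_2$ is the Hilbert-Schmidt norm. For $\mathcal{I}\subseteq\mathbb{N}$, $$\mathbf{r}_{\mathcal{I}}(\Sigma)=\sum_{i\in\mathcal{I}}\frac{\lambda_i}{\min_{j\notin\mathcal{I}}|\lambda_i-\lambda_j|}+\sum_{j\notin\mathcal{I}}\frac{\lambda_j}{\min_{i\in\mathcal{I}}|\lambda_j-\lambda_i|},$$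 where a term with zero denominator is $+\infty$, and a minimum over the empty set is $+\infty$ (so that the term is $0$). *)

theory Defs
  imports "HOL-Analysis.Analysis"
begin

text \<open>
  The scalars of a Hilbert space are the real or the complex numbers. Both are covered by one
  class: by the Gelfand-Mazur theorem a field with multiplicative norm over the reals is
  isomorphic to one of these two, and the last axiom forces \<open>conjg\<close> to be the usual conjugation.
\<close>

class rc_field = real_normed_field +
  fixes conjg :: "'a \<Rightarrow> 'a"
  assumes conjg_add: "conjg (a + b) = conjg a + conjg b"
    and conjg_mult: "conjg (a * b) = conjg a * conjg b"
    and conjg_conjg: "conjg (conjg a) = a"
    and mult_conjg: "a * conjg a = (norm a)\<^sup>2 *\<^sub>R 1"

instantiation real :: rc_field
begin
definition conjg_real :: "real \<Rightarrow> real" where "conjg_real a = a"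
instance by standard (simp_all add: conjg_real_def power2_eq_square)
end

instantiation complex :: rc_field
begin
definition conjg_complex :: "complex \<Rightarrow> complex" where "conjg_complex = cnj"
instance
  by standard
    (simp_all add: conjg_complex_def complex_norm_square[symmetric] scaleR_conv_of_real
      del: of_real_power)
end

text \<open>
  Norm, topology and completeness are those of the type class \<open>banach\<close>; the inner product
  \<open>ip\<close> is linear in its first argument and induces the norm.
\<close>

locale hilbert_space = vector_space smul
  for smul :: "'k::rc_field \<Rightarrow> 'a::banach \<Rightarrow> 'a" +
  fixes ip :: "'a \<Rightarrow> 'a \<Rightarrow> 'k"
  assumes smul_of_real: "smul (of_real r) v = r *\<^sub>R v"
    and ip_add_left: "ip (v + w) z = ip v z + ip w z"
    and ip_smul_left: "ip (smul c v) w = c * ip v w"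
    and ip_conjg: "ip w v = conjg (ip v w)"
    and ip_self: "ip v v = of_real ((norm v)\<^sup>2)"

lemma hilbert_space_real_inner:
  "hilbert_space scaleR (inner :: 'a::{real_inner, banach} \<Rightarrow> 'a \<Rightarrow> real)"
  by (rule hilbert_space.intro[OF real_vector.vector_space_axioms], unfold_locales)
     (simp_all add: inner_add_left conjg_real_def power2_norm_eq_inner, rule inner_commute)

lemma hilbert_space_complex:
  "hilbert_space (*) (\<lambda>v w :: complex. v * cnj w)"
  by unfold_locales
     (simp_all add: distrib_left distrib_right scaleR_conv_of_real conjg_complex_def
       complex_norm_square[symmetric] del: of_real_power)

definition orthonormal :: "('a \<Rightarrow> 'a \<Rightarrow> 'k::rc_field) \<Rightarrow> 'i set \<Rightarrow> ('i \<Rightarrow> 'a) \<Rightarrow> bool"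
  where "orthonormal ip J b \<longleftrightarrow>
    (\<forall>i\<in>J. \<forall>j\<in>J. ip (b i) (b j) = (if i = j then 1 else 0))"

definition onb :: "('k::rc_field \<Rightarrow> 'a::banach \<Rightarrow> 'a) \<Rightarrow> ('a \<Rightarrow> 'a \<Rightarrow> 'k) \<Rightarrow> 'i set \<Rightarrow> ('i \<Rightarrow> 'a) \<Rightarrow> bool"
  where "onb smul ip J b \<longleftrightarrow>
    orthonormal ip J b \<and> closure (module.span smul (b ` J)) = UNIV"

definition bounded_op :: "('k::rc_field \<Rightarrow> 'a::banach \<Rightarrow> 'a) \<Rightarrow> ('a \<Rightarrow> 'a) \<Rightarrow> bool"
  where "bounded_op smul T \<longleftrightarrow> Vector_Spaces.linear smul smul T \<and> bounded_linear T"

definition compact_op :: "('k::rc_field \<Rightarrow> 'a::banach \<Rightarrow> 'a) \<Rightarrow> ('a \<Rightarrow> 'a) \<Rightarrow> bool"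
  where "compact_op smul T \<longleftrightarrow> bounded_op smul T \<and> compact (closure (T ` cball 0 1))"

definition self_adjoint :: "('a \<Rightarrow> 'a \<Rightarrow> 'k::rc_field) \<Rightarrow> ('a \<Rightarrow> 'a) \<Rightarrow> bool"
  where "self_adjoint ip T \<longleftrightarrow> (\<forall>v w. ip (T v) w = ip v (T w))"

definition positive_op :: "('a \<Rightarrow> 'a \<Rightarrow> 'k::rc_field) \<Rightarrow> ('a \<Rightarrow> 'a) \<Rightarrow> bool"
  where "positive_op ip T \<longleftrightarrow> (\<forall>v. \<exists>r\<ge>0. ip (T v) v = of_real r)"

definition eigenvalue :: "('k::rc_field \<Rightarrow> 'a::banach \<Rightarrow> 'a) \<Rightarrow> ('a \<Rightarrow> 'a) \<Rightarrow> 'k \<Rightarrow> bool"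
  where "eigenvalue smul T c \<longleftrightarrow> (\<exists>v. v \<noteq> 0 \<and> T v = smul c v)"

definition strictly_positive ::
    "('k::rc_field \<Rightarrow> 'a::banach \<Rightarrow> 'a) \<Rightarrow> ('a \<Rightarrow> 'a \<Rightarrow> 'k) \<Rightarrow> ('a \<Rightarrow> 'a) \<Rightarrow> bool"
  where "strictly_positive smul ip T \<longleftrightarrow>
    positive_op ip T \<and> (\<forall>c. eigenvalue smul T c \<longrightarrow> (\<exists>r>0. c = of_real r))"

text \<open>
  The operator \<open>A\<close> below is the absolute value of \<open>T\<close>: as \<open>A\<close> is self-adjoint, the condition on
  the inner products says that the square of \<open>A\<close> is the adjoint of \<open>T\<close> times \<open>T\<close>.
\<close>

definition trace_class ::
    "('k::rc_field \<Rightarrow> 'a::banach \<Rightarrow> 'a) \<Rightarrow> ('a \<Rightarrow> 'a \<Rightarrow> 'k) \<Rightarrow> ('a \<Rightarrow> 'a) \<Rightarrow> bool"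
  where "trace_class smul ip T \<longleftrightarrow> bounded_op smul T \<and>
    (\<exists>A B. bounded_op smul A \<and> self_adjoint ip A \<and> positive_op ip A \<and>
       (\<forall>v w. ip (A v) (A w) = ip (T v) (T w)) \<and>
       onb smul ip B (\<lambda>e. e) \<and> (\<lambda>e. norm (ip (A e) e)) summable_on B)"

text \<open>
  The Hilbert-Schmidt norm, computed in an arbitrary orthonormal basis (its value does not depend
  on the choice). As \<open>infsum\<close> is 0 for families that are not summable, it is meaningful
  for Hilbert-Schmidt operators only, in particular for bounded operators of finite rank.
\<close>

definition hs_norm ::
    "('k::rc_field \<Rightarrow> 'a::banach \<Rightarrow> 'a) \<Rightarrow> ('a \<Rightarrow> 'a \<Rightarrow> 'k) \<Rightarrow> ('a \<Rightarrow> 'a) \<Rightarrow> real"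
  where "hs_norm smul ip T =
    sqrt (\<Sum>\<^sub>\<infinity>e\<in>(SOME B. onb smul ip B (\<lambda>e. e)). (norm (T e))\<^sup>2)"

definition proj ::
    "('k::rc_field \<Rightarrow> 'a::banach \<Rightarrow> 'a) \<Rightarrow> ('a \<Rightarrow> 'a \<Rightarrow> 'k) \<Rightarrow> 'a \<Rightarrow> 'a \<Rightarrow> 'a"
  where "proj smul ip u v = smul (ip v u) u"

definition proj_sum ::
    "('k::rc_field \<Rightarrow> 'a::banach \<Rightarrow> 'a) \<Rightarrow> ('a \<Rightarrow> 'a \<Rightarrow> 'k) \<Rightarrow> (nat \<Rightarrow> 'a) \<Rightarrow> nat set \<Rightarrow> 'a \<Rightarrow> 'a"
  where "proj_sum smul ip u I v = (\<Sum>i\<in>I. proj smul ip (u i) v)"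

definition indices :: "enat \<Rightarrow> nat set"
  where "indices p = {i. 1 \<le> i \<and> enat i \<le> p}"

text \<open>
  In \<^typ>\<open>ennreal\<close>, a positive number divided by 0 is \<open>\<top>\<close>, the infimum of the empty set is \<open>\<top>\<close>,
  and division by \<open>\<top>\<close> gives 0. For positive summable \<open>lam\<close>, the infima over nonempty sets are
  attained, hence minima, also for infinite sets.
\<close>

definition rel_rank :: "enat \<Rightarrow> (nat \<Rightarrow> real) \<Rightarrow> nat set \<Rightarrow> ennreal"
  where "rel_rank p lam I =
    (\<Sum>\<^sub>\<infinity>i\<in>I. ennreal (lam i) / (INF j\<in>indices p - I. ennreal \<bar>lam i - lam j\<bar>)) +
    (\<Sum>\<^sub>\<infinity>j\<in>indices p - I. ennreal (lam j) / (INF i\<in>I. ennreal \<bar>lam j - lam i\<bar>))"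

end

theory Submission
  imports Defs
begin

text \<open>
  The perturbed eigenspace is the graph of a small operator over the unperturbed one. With
  \<open>J\<close> the set of all indices and \<open>E = \<Sigma>h - \<Sigma>\<close>, look for vectors \<open>v k = u k + z k\<close> (\<open>k \<in> I\<close>), where
  \<open>z k\<close> is orthogonal to all \<open>u i\<close> with \<open>i \<in> I\<close>, whose span is invariant under \<open>\<Sigma>h\<close>. In coordinates,
  invariance is the quadratic (Riccati) equation
  \<open>(lam k - lam l) * ip (z k) (u l) = ip (E (v k)) (u l) - (\<Sum>m\<in>I. ip (z m) (u l) * ip (E (v k)) (u m))\<close>
  for \<open>l \<in> J - I\<close>. To first order its solution has entries of size at most
  \<open>s l k = x * sqrt (lam l * lam k) / \<bar>lam l - lam k\<bar>\<close>. Now bound \<open>z\<close> entry by entry by a multiple of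
  \<open>s\<close>. In each sum over products of entries of \<open>E\<close> and \<open>z\<close>, two factors \<open>sqrt (lam m)\<close> meet at the
  summation index \<open>m\<close>; what remains is \<open>s\<close> times \<open>x\<close> times a part of the relative rank of \<open>I\<close>, hence
  at most \<open>s / 8\<close>. So the equation is a contraction on the families bounded by \<open>2 * s\<close>, and has a
  solution there (\<open>graph_fixed_point\<close>).

  The graph is the span of the \<open>uh i\<close> with \<open>i \<in> I\<close>, for the following reason. If \<open>w\<close> is an
  eigenvector of \<open>\<Sigma>h\<close> whose eigenvalue is far from all \<open>lam k\<close> with \<open>k \<in> I\<close>, then the numbers
  \<open>ip (v k) w\<close> satisfy a homogeneous linear system that is diagonally dominant after weighting with
  \<open>sqrt (lam k)\<close>, and so they vanish (\<open>graph_orthogonal_eigenvector\<close>). This covers every \<open>uh j\<close> with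
  \<open>j \<in> J - I\<close>, since \<open>lamh j\<close> differs from \<open>lam j\<close> by at most half of the distance of \<open>lam j\<close> to
  the \<open>lam k\<close>, by the min-max principle (\<open>eigenvalue_perturbation\<close>); in infinite dimension it also
  covers the kernel of \<open>\<Sigma>h\<close>. Thus \<open>v k\<close> lies in the range of the perturbed projection
  (\<open>graph_in_range\<close>).

  Finally, the squared Hilbert-Schmidt distance of two projections of the same finite rank is at
  most twice the sum of the squared distances of the \<open>u k\<close> to the other range
  (\<open>hs_norm_proj_sum_diff_le\<close>). These are at most the squared norms of the \<open>z k\<close>, which gives the
  bound with \<open>2 * 4\<close> in place of \<open>16\<close>.
\<close>

section \<open>Geometry of a Hilbert space over the real or complex numbers\<close>

lemma conjg_0 [simp]: "conjg (0 :: 'k::rc_field) = 0"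
  using conjg_add[of "0::'k" 0] by simp

lemma conjg_minus [simp]: "conjg (- a :: 'k::rc_field) = - conjg a"
  using conjg_add[of a "- a"] by (simp add: eq_neg_iff_add_eq_0 add.commute)

lemma mult_conjg_of_real: "a * conjg a = of_real ((norm (a::'k::rc_field))\<^sup>2)"
  by (simp add: mult_conjg of_real_def)

lemma norm_conjg [simp]: "norm (conjg (a :: 'k::rc_field)) = norm a"
proof (cases "a = 0")
  case False
  have "norm (a * conjg a) = (norm a)\<^sup>2"
    by (simp only: mult_conjg_of_real norm_of_real) simp
  with False show ?thesis by (simp add: norm_mult power2_eq_square)
qed simp

text \<open>The axioms do not mention conjugation of real scalars, but \<open>a * conjg a\<close> is fixed by
  conjugation, and every nonnegative real is of this form.\<close>

lemma conjg_of_real [simp]: "conjg (of_real r :: 'k::rc_field) = of_real r"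
proof -
  have nonneg: "conjg (of_real s :: 'k) = of_real s" if "s \<ge> 0" for s
  proof -
    define a :: 'k where "a = of_real (sqrt s)"
    have s: "of_real s = a * conjg a"
      using that by (simp add: mult_conjg_of_real a_def)
    show ?thesis unfolding s conjg_mult conjg_conjg by (rule mult.commute)
  qed
  show ?thesis
  proof (cases "r \<ge> 0")
    case False
    then show ?thesis using nonneg[of "- r"] by simp
  qed (rule nonneg)
qed

context hilbert_space
begin

lemma ip_zero_left [simp]: "ip 0 v = 0"
  using ip_add_left[of 0 0 v] by simp

lemma ip_zero_right [simp]: "ip v 0 = 0"
  by (subst ip_conjg) simp

lemma ip_add_right: "ip z (v + w) = ip z v + ip z w"
  by (metis ip_conjg ip_add_left conjg_add)

lemma ip_smul_right: "ip v (smul c w) = conjg c * ip v w"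
  by (metis ip_conjg ip_smul_left conjg_mult)

lemma ip_minus_left [simp]: "ip (- v) w = - ip v w"
  using ip_add_left[of v "- v" w] by (simp add: eq_neg_iff_add_eq_0 add.commute)

lemma ip_minus_right [simp]: "ip v (- w) = - ip v w"
  using ip_add_right[of v w "- w"] by (simp add: eq_neg_iff_add_eq_0 add.commute)

lemma ip_diff_left: "ip (v - w) z = ip v z - ip w z"
  using ip_add_left[of v "- w" z] by simp

lemma ip_diff_right: "ip z (v - w) = ip z v - ip z w"
  using ip_add_right[of z v "- w"] by simp

lemma ip_sum_left: "ip (\<Sum>i\<in>F. f i) w = (\<Sum>i\<in>F. ip (f i) w)"
  by (induction F rule: infinite_finite_induct) (auto simp: ip_add_left)

lemma ip_sum_right: "ip w (\<Sum>i\<in>F. f i) = (\<Sum>i\<in>F. ip w (f i))"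
  by (induction F rule: infinite_finite_induct) (auto simp: ip_add_right)

lemma norm_ip_commute: "norm (ip v w) = norm (ip w v)"
  by (metis ip_conjg norm_conjg)

lemma ip_mult_ip_swap: "ip v w * ip w v = of_real ((norm (ip v w))\<^sup>2)"
  unfolding mult_conjg_of_real[symmetric] ip_conjg[symmetric] ..

lemma ip_eq_0_commute: "ip v w = 0 \<longleftrightarrow> ip w v = 0"
  by (metis norm_eq_zero norm_ip_commute)

lemma pythagoras:
  assumes "ip v w = 0"
  shows "(norm (v + w))\<^sup>2 = (norm v)\<^sup>2 + (norm w)\<^sup>2"
proof -
  have "of_real ((norm (v + w))\<^sup>2) = (of_real ((norm v)\<^sup>2 + (norm w)\<^sup>2) :: 'k)"
    using assms ip_eq_0_commute[of v w]
    unfolding ip_self[symmetric] of_real_add by (simp add: ip_add_left ip_add_right)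
  then show ?thesis using of_real_eq_iff by blast
qed

lemma norm_smul: "norm (smul c v) = norm c * norm v"
proof -
  have "of_real ((norm (smul c v))\<^sup>2) = (of_real ((norm c * norm v)\<^sup>2) :: 'k)"
    unfolding ip_self[symmetric] power_mult_distrib of_real_mult
    unfolding ip_self[symmetric] mult_conjg_of_real[symmetric]
    by (simp add: ip_smul_left ip_smul_right)
  then have "(norm (smul c v))\<^sup>2 = (norm c * norm v)\<^sup>2" using of_real_eq_iff by blast
  then show ?thesis by (simp add: power2_eq_iff_nonneg)
qed

lemma norm_1_if_ip_self: "ip v v = 1 \<Longrightarrow> norm v = 1"
proof -
  assume "ip v v = 1"
  then have "(of_real ((norm v)\<^sup>2) :: 'k) = of_real 1" by (simp only: ip_self of_real_1)
  then have "(norm v)\<^sup>2 = 1" using of_real_eq_iff by blast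
  then show ?thesis using norm_ge_zero[of v] by (auto simp: power2_eq_1_iff)
qed

lemma orthonormal_norm: "orthonormal ip J b \<Longrightarrow> i \<in> J \<Longrightarrow> norm (b i) = 1"
  by (intro norm_1_if_ip_self) (simp add: orthonormal_def)

lemma orthonormal_subset: "orthonormal ip J b \<Longrightarrow> F \<subseteq> J \<Longrightarrow> orthonormal ip F b"
  unfolding orthonormal_def by blast

lemma orthonormal_inj_on: "orthonormal ip J b \<Longrightarrow> inj_on b J"
  unfolding orthonormal_def inj_on_def by (metis zero_neq_one)

lemma ip_lincomb_orthonormal:
  assumes "orthonormal ip J b" "finite J" "j \<in> J"
  shows "ip (\<Sum>i\<in>J. smul (c i) (b i)) (b j) = c j"
proof -
  have "ip (\<Sum>i\<in>J. smul (c i) (b i)) (b j) = (\<Sum>i\<in>J. if i = j then c i else 0)"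
    unfolding ip_sum_left ip_smul_left
    by (intro sum.cong) (use assms in \<open>auto simp: orthonormal_def\<close>)
  then show ?thesis using assms by simp
qed

lemma norm_lincomb_orthonormal:
  assumes "orthonormal ip J b" "finite J"
  shows "(norm (\<Sum>i\<in>J. smul (c i) (b i)))\<^sup>2 = (\<Sum>i\<in>J. (norm (c i))\<^sup>2)"
proof -
  have "of_real ((norm (\<Sum>i\<in>J. smul (c i) (b i)))\<^sup>2) = (\<Sum>i\<in>J. conjg (c i) * c i)"
    unfolding ip_self[symmetric]
    by (subst ip_sum_right)
       (use assms in \<open>auto simp: ip_smul_right ip_lincomb_orthonormal intro!: sum.cong\<close>)
  also have "\<dots> = (of_real (\<Sum>i\<in>J. (norm (c i))\<^sup>2) :: 'k)"
    unfolding of_real_sum mult_conjg_of_real[symmetric] by (simp add: mult.commute)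
  finally show ?thesis using of_real_eq_iff by blast
qed

lemma ip_residual_orthonormal:
  assumes "orthonormal ip J b" "finite J" "j \<in> J"
  shows "ip (v - (\<Sum>i\<in>J. smul (ip v (b i)) (b i))) (b j) = 0"
  using ip_lincomb_orthonormal[OF assms, of "\<lambda>i. ip v (b i)"] by (simp add: ip_diff_left)

text \<open>The last sum is the price of using other coefficients than \<open>ip v (b i)\<close>. This gives both
  the best approximation property and, for zero coefficients, Bessel's inequality.\<close>

lemma norm_diff_lincomb_orthonormal:
  assumes "orthonormal ip J b" "finite J"
  shows "(norm (v - (\<Sum>i\<in>J. smul (c i) (b i))))\<^sup>2 =
    (norm (v - (\<Sum>i\<in>J. smul (ip v (b i)) (b i))))\<^sup>2 + (\<Sum>i\<in>J. (norm (ip v (b i) - c i))\<^sup>2)"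
proof -
  let ?r = "v - (\<Sum>i\<in>J. smul (ip v (b i)) (b i))"
  let ?s = "\<Sum>i\<in>J. smul (ip v (b i) - c i) (b i)"
  have "ip ?r ?s = 0"
    unfolding ip_sum_right ip_smul_right using assms
    by (intro sum.neutral) (simp add: ip_residual_orthonormal)
  moreover have "v - (\<Sum>i\<in>J. smul (c i) (b i)) = ?r + ?s"
    by (simp add: scale_left_diff_distrib sum_subtractf)
  ultimately show ?thesis
    using pythagoras[of ?r ?s] norm_lincomb_orthonormal[OF assms] by metis
qed

lemma norm_residual_orthonormal:
  assumes "orthonormal ip J b" "finite J"
  shows "(norm (v - (\<Sum>i\<in>J. smul (ip v (b i)) (b i))))\<^sup>2 =
    (norm v)\<^sup>2 - (\<Sum>i\<in>J. (norm (ip v (b i)))\<^sup>2)"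
  using norm_diff_lincomb_orthonormal[OF assms, of v "\<lambda>_. 0"] by simp

lemma bessel:
  assumes "orthonormal ip J b" "finite J"
  shows "(\<Sum>i\<in>J. (norm (ip v (b i)))\<^sup>2) \<le> (norm v)\<^sup>2"
  using norm_residual_orthonormal[OF assms, of v] zero_le_power2
  by (metis diff_ge_0_iff_ge)

lemma bessel_summable:
  assumes "orthonormal ip J b"
  shows "(\<lambda>i. (norm (ip v (b i)))\<^sup>2) summable_on J"
    and "(\<Sum>\<^sub>\<infinity>i\<in>J. (norm (ip v (b i)))\<^sup>2) \<le> (norm v)\<^sup>2"
proof -
  have fin: "(\<Sum>i\<in>F. (norm (ip v (b i)))\<^sup>2) \<le> (norm v)\<^sup>2" if "finite F" "F \<subseteq> J" for F
    using bessel orthonormal_subset[OF assms that(2)] that(1) by blast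
  show summ: "(\<lambda>i. (norm (ip v (b i)))\<^sup>2) summable_on J"
    by (rule nonneg_bdd_above_summable_on)
       (use fin in \<open>auto intro!: bdd_aboveI[where M = "(norm v)\<^sup>2"]\<close>)
  show "(\<Sum>\<^sub>\<infinity>i\<in>J. (norm (ip v (b i)))\<^sup>2) \<le> (norm v)\<^sup>2"
    by (rule infsum_le_finite_sums[OF summ fin])
qed

lemma cauchy_schwarz: "norm (ip v w) \<le> norm v * norm w"
proof (cases "w = 0")
  case False
  define b where "b = smul (of_real (1 / norm w)) w"
  have w: "w = smul (of_real (norm w)) b"
    using False by (simp add: b_def scale_scale flip: of_real_mult)
  have "ip b b = 1"
  proof -
    have "norm b = 1" using False by (simp add: b_def norm_smul norm_divide)
    then show ?thesis using ip_self[of b] by simp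
  qed
  then have on: "orthonormal ip {b} (\<lambda>e. e)" by (simp add: orthonormal_def)
  have "(norm (ip v b))\<^sup>2 \<le> (norm v)\<^sup>2" using bessel[OF on, of v] by simp
  then have "norm (ip v b) \<le> norm v" by (simp add: power2_le_iff_abs_le)
  then have "norm (ip v b) * norm w \<le> norm v * norm w" by (rule mult_right_mono) simp
  also have "norm (ip v b) * norm w = norm (ip v w)"
    by (subst (2) w) (simp add: ip_smul_right norm_mult)
  finally show ?thesis .
qed simp

lemma bounded_linear_ip_left: "bounded_linear (\<lambda>v. ip v w)"
proof (rule bounded_linear_intro[where K = "norm w"])
  show "ip (r *\<^sub>R v) w = r *\<^sub>R ip v w" for r v
    unfolding smul_of_real[symmetric] ip_smul_left by (simp add: scaleR_conv_of_real)
qed (simp_all add: ip_add_left cauchy_schwarz)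

subsection \<open>Orthonormal bases\<close>

text \<open>Partial sums of the Fourier expansion are best approximations, and they only improve when
  the index set grows; so density of the linear span forces unconditional convergence.\<close>

lemma onb_expansion:
  assumes "onb smul ip J b"
  shows "((\<lambda>i. smul (ip v (b i)) (b i)) has_sum v) J"
proof -
  have on: "orthonormal ip J b" and dense: "closure (span (b ` J)) = UNIV"
    using assms by (auto simp: onb_def)
  show ?thesis
    unfolding has_sum_def
  proof (rule tendstoI)
    fix \<epsilon> :: real assume "\<epsilon> > 0"
    have "v \<in> closure (span (b ` J))" using dense by simp
    then obtain s where s: "s \<in> span (b ` J)" "dist s v < \<epsilon>"
      using \<open>\<epsilon> > 0\<close> by (auto simp: closure_approachable)
    then obtain t r where t: "finite t" "t \<subseteq> b ` J" "s = (\<Sum>a\<in>t. smul (r a) a)"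
      by (auto simp: span_explicit)
    then obtain F where F: "finite F" "F \<subseteq> J" "t = b ` F"
      by (meson finite_subset_image)
    have s_eq: "s = (\<Sum>i\<in>F. smul (r (b i)) (b i))"
      unfolding t(3) F(3)
      by (rule sum.reindex_cong[OF inj_on_subset[OF orthonormal_inj_on[OF on] F(2)]]) auto
    have close: "dist (\<Sum>i\<in>G. smul (ip v (b i)) (b i)) v < \<epsilon>"
      if G: "finite G" "F \<subseteq> G" "G \<subseteq> J" for G
    proof -
      define c where "c = (\<lambda>i. if i \<in> F then r (b i) else 0)"
      have s_G: "s = (\<Sum>i\<in>G. smul (c i) (b i))"
        unfolding s_eq by (rule sum.mono_neutral_cong_left) (use G in \<open>auto simp: c_def\<close>)
      have "(norm (v - (\<Sum>i\<in>G. smul (ip v (b i)) (b i))))\<^sup>2 \<le> (norm (v - s))\<^sup>2"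
        unfolding s_G
        using norm_diff_lincomb_orthonormal[OF orthonormal_subset[OF on G(3)] G(1), of v c]
        by (simp add: sum_nonneg)
      then have "norm (v - (\<Sum>i\<in>G. smul (ip v (b i)) (b i))) \<le> norm (v - s)"
        by (simp add: power2_le_iff_abs_le)
      also have "\<dots> < \<epsilon>" using s(2) by (simp add: dist_norm norm_minus_commute)
      finally show ?thesis by (simp add: dist_norm norm_minus_commute)
    qed
    then show "\<forall>\<^sub>F G in finite_subsets_at_top J. dist (\<Sum>i\<in>G. smul (ip v (b i)) (b i)) v < \<epsilon>"
      unfolding eventually_finite_subsets_at_top using F by blast
  qed
qed

lemma onb_orthonormal: "onb smul ip J b \<Longrightarrow> orthonormal ip J b"
  by (simp add: onb_def)

lemma onb_image: "onb smul ip J b \<Longrightarrow> onb smul ip (b ` J) (\<lambda>e. e)"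
  using orthonormal_inj_on[of J b] unfolding onb_def
  by (auto simp: orthonormal_def inj_on_eq_iff)

text \<open>Inner products with a fixed vector are continuous, so the Fourier expansion can be
  paired term by term.\<close>

lemma parseval_ip:
  assumes "onb smul ip J b"
  shows "((\<lambda>i. ip v (b i) * ip (b i) w) has_sum ip v w) J"
  using has_sum_bounded_linear[OF bounded_linear_ip_left[of w] onb_expansion[OF assms, of v]]
  by (simp add: ip_smul_left)

lemma parseval:
  assumes "onb smul ip J b"
  shows "((\<lambda>i. (norm (ip v (b i)))\<^sup>2) has_sum (norm v)\<^sup>2) J"
proof -
  have "((\<lambda>i. of_real ((norm (ip v (b i)))\<^sup>2) :: 'k) has_sum of_real ((norm v)\<^sup>2)) J"
    using parseval_ip[OF assms, of v v]
    unfolding ip_self mult_conjg_of_real[symmetric] ip_conjg[symmetric] .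
  then show ?thesis unfolding has_sum_of_real_iff .
qed

lemma onb_eqI:
  assumes "onb smul ip J b" "\<And>i. i \<in> J \<Longrightarrow> ip v (b i) = ip w (b i)"
  shows "v = w"
proof -
  have "((\<lambda>i. smul (ip v (b i)) (b i)) has_sum w) J"
    using onb_expansion[OF assms(1), of w] by (rule has_sum_cong[THEN iffD1, rotated]) (simp add: assms(2))
  then show ?thesis using onb_expansion[OF assms(1), of v] has_sum_unique by blast
qed

text \<open>The partial sums are Cauchy because their increments have orthogonal terms; an infinite
  orthogonal series need not converge absolutely.\<close>

lemma riesz_fischer:
  fixes b :: "nat \<Rightarrow> 'a"
  assumes on: "orthonormal ip J b" and sq: "(\<lambda>i. (norm (c i))\<^sup>2) summable_on J"
  obtains z where "\<And>j. j \<in> J \<Longrightarrow> ip z (b j) = c j"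
proof -
  define S where "S n = (\<Sum>i\<in>J \<inter> {..<n}. smul (c i) (b i))" for n
  define q where "q i = (if i \<in> J then (norm (c i))\<^sup>2 else 0)" for i
  have "q summable_on UNIV"
    using sq by (rule summable_on_cong_neutral[THEN iffD1, rotated -1]) (auto simp: q_def)
  then have q: "summable q" by (rule summable_on_imp_summable)
  have inc: "(norm (S n - S m))\<^sup>2 = sum q {m..<n}" if "m \<le> n" for m n
  proof -
    have "S n = S m + (\<Sum>i\<in>J \<inter> {m..<n}. smul (c i) (b i))"
      unfolding S_def
      by (subst sum.union_disjoint[symmetric]) (use that in \<open>auto intro!: sum.cong\<close>)
    then have "(norm (S n - S m))\<^sup>2 = (\<Sum>i\<in>J \<inter> {m..<n}. (norm (c i))\<^sup>2)"
      by (simp add: norm_lincomb_orthonormal[OF orthonormal_subset[OF on]])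
    also have "\<dots> = sum q {m..<n}"
      by (rule sum.mono_neutral_cong_left) (auto simp: q_def)
    finally show ?thesis .
  qed
  have "Cauchy S"
  proof (rule CauchyI')
    fix \<epsilon> :: real assume "\<epsilon> > 0"
    then obtain N where N: "\<And>m n. m \<ge> N \<Longrightarrow> norm (sum q {m..<n}) < \<epsilon>\<^sup>2"
      using q unfolding summable_Cauchy by (meson zero_less_power)
    have "norm (S m - S n) < \<epsilon>" if "m \<ge> N" "n > m" for m n
    proof -
      have "(norm (S n - S m))\<^sup>2 < \<epsilon>\<^sup>2"
        using inc[of m n] N[of m n] that by auto
      then show ?thesis
        using \<open>\<epsilon> > 0\<close> by (simp add: norm_minus_commute power2_less_imp_less)
    qed
    then show "\<exists>M. \<forall>m\<ge>M. \<forall>n>m. dist (S m) (S n) < \<epsilon>" by (auto simp: dist_norm)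
  qed
  then obtain z where z: "S \<longlonglongrightarrow> z" by (auto simp: Cauchy_convergent_iff convergent_def)
  have lim: "(\<lambda>n. ip (S n) w) \<longlonglongrightarrow> ip z w" for w
    by (rule bounded_linear.tendsto[OF bounded_linear_ip_left z])
  show ?thesis
  proof
    fix j assume j: "j \<in> J"
    have "\<forall>\<^sub>F n in sequentially. ip (S n) (b j) = c j"
      using eventually_gt_at_top[of j]
      by eventually_elim
         (use j in \<open>auto simp: S_def intro!: ip_lincomb_orthonormal orthonormal_subset[OF on]\<close>)
    then have "(\<lambda>n. ip (S n) (b j)) \<longlonglongrightarrow> c j" by (rule tendsto_eventually)
    then show "ip z (b j) = c j" using lim[of "b j"] LIMSEQ_unique by blast
  qed
qed

end

section \<open>Sums and linear systems\<close>

lemma has_sum_finite_sum: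
  fixes f :: "'i \<Rightarrow> 'j \<Rightarrow> real"
  assumes "\<And>i. i \<in> F \<Longrightarrow> (f i has_sum s i) J"
  shows "((\<lambda>j. \<Sum>i\<in>F. f i j) has_sum (\<Sum>i\<in>F. s i)) J"
  using assms by (induction F rule: infinite_finite_induct) (auto intro: has_sum_add)

lemma norm_has_sum_le:
  fixes f :: "'i \<Rightarrow> 'b::real_normed_vector"
  assumes f: "(f has_sum s) J" and g: "(g has_sum t) J"
    and le: "\<And>i. i \<in> J \<Longrightarrow> norm (f i) \<le> g i"
  shows "norm s \<le> t"
proof -
  have "(\<lambda>i. norm (f i)) summable_on J"
    by (rule summable_on_comparison_test[OF has_sum_imp_summable[OF g]]) (use le in auto)
  then have n: "((\<lambda>i. norm (f i)) has_sum (\<Sum>\<^sub>\<infinity>i\<in>J. norm (f i))) J" by simp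
  show ?thesis
    using norm_has_sum_bound[OF n f] has_sum_mono[OF n g] le by force
qed

lemma cauchy_schwarz_infsum:
  fixes f g :: "'i \<Rightarrow> real"
  assumes f: "(\<lambda>i. (f i)\<^sup>2) summable_on J" and g: "(\<lambda>i. (g i)\<^sup>2) summable_on J"
    and nonneg: "\<And>i. i \<in> J \<Longrightarrow> 0 \<le> f i" "\<And>i. i \<in> J \<Longrightarrow> 0 \<le> g i"
  shows "(\<lambda>i. f i * g i) summable_on J"
    and "(\<Sum>\<^sub>\<infinity>i\<in>J. f i * g i)\<^sup>2 \<le> (\<Sum>\<^sub>\<infinity>i\<in>J. (f i)\<^sup>2) * (\<Sum>\<^sub>\<infinity>i\<in>J. (g i)\<^sup>2)"
proof -
  let ?P = "(\<Sum>\<^sub>\<infinity>i\<in>J. (f i)\<^sup>2) * (\<Sum>\<^sub>\<infinity>i\<in>J. (g i)\<^sup>2)"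
  have fin: "(\<Sum>i\<in>F. f i * g i) \<le> sqrt ?P" if F: "finite F" "F \<subseteq> J" for F
  proof -
    have "(\<Sum>i\<in>F. f i * g i)\<^sup>2 \<le> (\<Sum>i\<in>F. (f i)\<^sup>2) * (\<Sum>i\<in>F. (g i)\<^sup>2)"
      by (rule Cauchy_Schwarz_ineq_sum)
    also have "\<dots> \<le> ?P"
      by (intro mult_mono finite_sum_le_infsum f g F sum_nonneg infsum_nonneg) auto
    finally show ?thesis by (rule real_le_rsqrt)
  qed
  show summ: "(\<lambda>i. f i * g i) summable_on J"
    by (rule nonneg_bdd_above_summable_on)
       (use fin nonneg in \<open>auto intro!: bdd_aboveI[where M = "sqrt ?P"]\<close>)
  have "(\<Sum>\<^sub>\<infinity>i\<in>J. f i * g i) \<le> sqrt ?P"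
    by (rule infsum_le_finite_sums[OF summ fin])
  moreover have "0 \<le> (\<Sum>\<^sub>\<infinity>i\<in>J. f i * g i)"
    using nonneg by (intro infsum_nonneg) auto
  moreover have "0 \<le> ?P" by (intro mult_nonneg_nonneg infsum_nonneg) auto
  ultimately show "(\<Sum>\<^sub>\<infinity>i\<in>J. f i * g i)\<^sup>2 \<le> ?P"
    using power_mono[of "(\<Sum>\<^sub>\<infinity>i\<in>J. f i * g i)" "sqrt ?P" 2] by simp
qed

text \<open>Gaussian elimination of one unknown per equation.\<close>

lemma homogeneous_system_nontrivial:
  fixes A :: "'r \<Rightarrow> 'i \<Rightarrow> 'k::field"
  assumes "finite R" "finite J" "card R < card J"
  shows "\<exists>c. (\<exists>i\<in>J. c i \<noteq> 0) \<and> (\<forall>r\<in>R. (\<Sum>i\<in>J. c i * A r i) = 0)"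
  using assms
proof (induction R arbitrary: J A rule: finite_induct)
  case empty
  then have "J \<noteq> {}" by auto
  then show ?case by (intro exI[of _ "\<lambda>_. 1"]) auto
next
  case (insert r R)
  show ?case
  proof (cases "\<forall>i\<in>J. A r i = 0")
    case True
    have "card R < card J" using insert by simp
    from insert.IH[OF insert.prems(1) this, of A] True show ?thesis by auto
  next
    case False
    then obtain i0 where i0: "i0 \<in> J" "A r i0 \<noteq> 0" by blast
    define J' where "J' = J - {i0}"
    have J: "J = insert i0 J'" "i0 \<notin> J'" "finite J'"
      using i0 insert.prems by (auto simp: J'_def)
    have "card R < card J'"
      using insert J by auto
    then obtain c where c: "\<exists>i\<in>J'. c i \<noteq> 0"
      "\<And>s. s \<in> R \<Longrightarrow> (\<Sum>i\<in>J'. c i * (A s i - A s i0 * A r i / A r i0)) = 0"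
      using insert.IH[OF J(3), of "\<lambda>s i. A s i - A s i0 * A r i / A r i0"] by blast
    define a where "a = - (\<Sum>i\<in>J'. c i * A r i) / A r i0"
    have sum_eq: "(\<Sum>i\<in>J. (c(i0 := a)) i * A s i) = a * A s i0 + (\<Sum>i\<in>J'. c i * A s i)" for s
      unfolding J(1) using J(2,3) by (auto intro!: arg_cong2[of _ _ _ _ "(+)"] sum.cong)
    have "(\<Sum>i\<in>J. (c(i0 := a)) i * A s i) = 0" if s: "s \<in> insert r R" for s
    proof (cases "s = r")
      case True
      show ?thesis unfolding sum_eq unfolding a_def True using i0 by simp
    next
      case False
      have "(\<Sum>i\<in>J'. c i * A s i) - (\<Sum>i\<in>J'. c i * A r i) * (A s i0 / A r i0) = 0"
        using c(2)[of s] s False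
        by (simp add: right_diff_distrib sum_subtractf sum_distrib_left sum_divide_distrib ac_simps)
      then have *: "(\<Sum>i\<in>J'. c i * A s i) = (\<Sum>i\<in>J'. c i * A r i) * (A s i0 / A r i0)"
        by simp
      show ?thesis unfolding sum_eq unfolding a_def * by simp
    qed
    moreover have "\<exists>i\<in>J. (c(i0 := a)) i \<noteq> 0"
      using c(1) J by auto
    ultimately show ?thesis by blast
  qed
qed

section \<open>Hilbert-Schmidt norms of finite rank operators\<close>

context hilbert_space
begin

text \<open>The dimension count behind the min-max principle.\<close>

lemma orthogonal_combination:
  assumes on: "orthonormal ip J w" and fin: "finite J" "finite R" "card R < card J"
  obtains c where "(\<Sum>i\<in>J. smul (c i) (w i)) \<noteq> 0"
    and "\<And>r. r \<in> R \<Longrightarrow> ip (\<Sum>i\<in>J. smul (c i) (w i)) (e r) = 0"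
proof -
  obtain c where c: "\<exists>i\<in>J. c i \<noteq> 0" "\<And>r. r \<in> R \<Longrightarrow> (\<Sum>i\<in>J. c i * ip (w i) (e r)) = 0"
    using homogeneous_system_nontrivial[OF fin(2,1,3), of "\<lambda>r i. ip (w i) (e r)"] by blast
  show ?thesis
  proof
    show "(\<Sum>i\<in>J. smul (c i) (w i)) \<noteq> 0"
      using c(1) ip_lincomb_orthonormal[OF on fin(1), of _ c] by fastforce
    show "ip (\<Sum>i\<in>J. smul (c i) (w i)) (e r) = 0" if "r \<in> R" for r
      using c(2)[OF that] by (simp add: ip_sum_left ip_smul_left)
  qed
qed

lemma some_onb:
  assumes "onb smul ip J b"
  shows "onb smul ip (SOME B. onb smul ip B (\<lambda>e. e)) (\<lambda>e. e)"
  using onb_image[OF assms] by (rule someI)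

text \<open>Passing to the adjoint exchanges the two bases in the double sum of the squared matrix
  entries; Bessel's inequality then bounds the norm in the chosen basis by the sum over any
  other one.\<close>

lemma hs_norm_self_adjoint_le:
  assumes b: "onb smul ip J b" and T: "self_adjoint ip T"
    and S: "((\<lambda>a. (norm (T (b a)))\<^sup>2) has_sum S) J"
  shows "(hs_norm smul ip T)\<^sup>2 \<le> S"
proof -
  define B where "B = (SOME B. onb smul ip B (\<lambda>e. e))"
  have B: "orthonormal ip B (\<lambda>e. e)"
    unfolding B_def by (rule onb_orthonormal[OF some_onb[OF b]])
  have swap: "norm (ip (T e) w) = norm (ip (T w) e)" for e w
    using T by (metis norm_ip_commute self_adjoint_def)
  have fin: "(\<Sum>e\<in>F. (norm (T e))\<^sup>2) \<le> S" if F: "finite F" "F \<subseteq> B" for F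
  proof (rule has_sum_mono)
    show "((\<lambda>a. \<Sum>e\<in>F. (norm (ip (T e) (b a)))\<^sup>2) has_sum (\<Sum>e\<in>F. (norm (T e))\<^sup>2)) J"
      by (intro has_sum_finite_sum parseval[OF b])
    show "(\<Sum>e\<in>F. (norm (ip (T e) (b a)))\<^sup>2) \<le> (norm (T (b a)))\<^sup>2" for a
      unfolding swap[of _ "b a"] by (rule bessel[OF orthonormal_subset[OF B F(2)] F(1)])
  qed (rule S)
  have "0 \<le> S" using fin[of "{}"] by simp
  moreover have "(\<Sum>\<^sub>\<infinity>e\<in>B. (norm (T e))\<^sup>2) \<le> S"
  proof (cases "(\<lambda>e. (norm (T e))\<^sup>2) summable_on B")
    case True
    then show ?thesis using fin by (rule infsum_le_finite_sums)
  next
    case False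
    then show ?thesis using \<open>0 \<le> S\<close> by (simp add: infsum_not_exists)
  qed
  moreover have "0 \<le> (\<Sum>\<^sub>\<infinity>e\<in>B. (norm (T e))\<^sup>2)" by (intro infsum_nonneg) auto
  ultimately show ?thesis by (simp add: hs_norm_def B_def)
qed

text \<open>This turns the hypothesis on \<open>P\<^sub>i E P\<^sub>j\<close> into a bound on matrix entries.\<close>

lemma hs_norm_proj_comp_proj:
  assumes b: "onb smul ip J b" and ij: "i \<in> J" "j \<in> J"
    and T: "\<And>c v. T (smul c v) = smul c (T v)"
  shows "hs_norm smul ip (proj smul ip (b i) \<circ> T \<circ> proj smul ip (b j)) = norm (ip (T (b j)) (b i))"
proof -
  define B where "B = (SOME B. onb smul ip B (\<lambda>e. e))"
  have B: "onb smul ip B (\<lambda>e. e)" unfolding B_def by (rule some_onb[OF b])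
  have 1: "norm (b i) = 1" "norm (b j) = 1"
    using ij orthonormal_norm[OF onb_orthonormal[OF b]] by auto
  have "((\<lambda>e. (norm (ip (b j) e))\<^sup>2 * (norm (ip (T (b j)) (b i)))\<^sup>2)
      has_sum (norm (b j))\<^sup>2 * (norm (ip (T (b j)) (b i)))\<^sup>2) B"
    by (intro has_sum_cmult_left parseval[OF B])
  moreover have "norm ((proj smul ip (b i) \<circ> T \<circ> proj smul ip (b j)) e)
      = norm (ip (b j) e) * norm (ip (T (b j)) (b i))" for e
    unfolding proj_def using 1
    by (simp add: T ip_smul_left norm_smul norm_mult norm_ip_commute[of e])
  ultimately have "((\<lambda>e. (norm ((proj smul ip (b i) \<circ> T \<circ> proj smul ip (b j)) e))\<^sup>2)
      has_sum (norm (ip (T (b j)) (b i)))\<^sup>2) B"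
    using 1 by (simp add: power_mult_distrib)
  then show ?thesis unfolding hs_norm_def B_def[symmetric] by (simp add: infsumI)
qed

lemma self_adjoint_proj_sum: "self_adjoint ip (proj_sum smul ip b I)"
  unfolding self_adjoint_def proj_sum_def proj_def ip_sum_left ip_sum_right ip_smul_left ip_smul_right
    ip_conjg[symmetric]
  by (simp add: mult.commute)

text \<open>Both projections have rank \<open>card I\<close>. By Parseval for the \<open>w i\<close>, the mass that the
  range of one misses in the other is the same in either direction, so the directions in \<open>I\<close>
  account for one half of the norm.\<close>

lemma hs_norm_proj_sum_diff_le:
  assumes b: "onb smul ip J b" and I: "finite I" "I \<subseteq> J" and w: "orthonormal ip I w"
  shows "(hs_norm smul ip (\<lambda>v. proj_sum smul ip w I v - proj_sum smul ip b I v))\<^sup>2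
    \<le> 2 * (\<Sum>k\<in>I. (norm (b k - proj_sum smul ip w I (b k)))\<^sup>2)"
proof -
  let ?P = "proj_sum smul ip b I" and ?Q = "proj_sum smul ip w I"
  define s where "s a = (\<Sum>i\<in>I. (norm (ip (b a) (w i)))\<^sup>2)" for a
  have on: "orthonormal ip J b" by (rule onb_orthonormal[OF b])
  have s: "(s has_sum (\<Sum>i\<in>I. (norm (w i))\<^sup>2)) J"
    unfolding s_def norm_ip_commute[of "b _"]
    by (intro has_sum_finite_sum parseval[OF b])
  have w1: "(\<Sum>i\<in>I. (norm (w i))\<^sup>2) = card I"
    using orthonormal_norm[OF w] by simp
  have d: "(norm (b k - ?Q (b k)))\<^sup>2 = 1 - s k" if "k \<in> I" for k
    using norm_residual_orthonormal[OF w I(1), of "b k"] orthonormal_norm[OF on, of k] that I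
    by (auto simp: proj_sum_def proj_def s_def)
  have Pb: "?P (b a) = (if a \<in> I then b a else 0)" if "a \<in> J" for a
  proof -
    have "?P (b a) = (\<Sum>i\<in>I. if i = a then b a else 0)"
      unfolding proj_sum_def proj_def
      by (intro sum.cong) (use on that I in \<open>auto simp: orthonormal_def\<close>)
    then show ?thesis using I by simp
  qed
  have terms: "(norm (?Q (b a) - ?P (b a)))\<^sup>2 = s a + (if a \<in> I then 1 - 2 * s a else 0)"
    if "a \<in> J" for a
  proof (cases "a \<in> I")
    case True
    then show ?thesis using d[of a] that by (simp add: Pb norm_minus_commute)
  next
    case False
    then show ?thesis
      using that norm_lincomb_orthonormal[OF w I(1), of "\<lambda>i. ip (b a) (w i)"]
      by (simp add: Pb) (simp add: proj_sum_def proj_def s_def)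
  qed
  have "((\<lambda>a. if a \<in> I then 1 - 2 * s a else 0) has_sum (\<Sum>a\<in>I. 1 - 2 * s a)) J"
    by (rule has_sum_finite_neutralI) (use I in auto)
  from has_sum_add[OF s this]
  have total: "((\<lambda>a. (norm (?Q (b a) - ?P (b a)))\<^sup>2) has_sum
      (card I + (\<Sum>a\<in>I. 1 - 2 * s a))) J"
    unfolding w1 by (rule has_sum_cong[THEN iffD2, rotated]) (rule terms)
  have "self_adjoint ip (\<lambda>v. ?Q v - ?P v)"
    using self_adjoint_proj_sum unfolding self_adjoint_def by (simp add: ip_diff_left ip_diff_right)
  from hs_norm_self_adjoint_le[OF b this total]
  moreover have "card I + (\<Sum>a\<in>I. 1 - 2 * s a) = 2 * (\<Sum>k\<in>I. 1 - s k)"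
    by (simp add: sum_subtractf sum_distrib_left[symmetric])
  ultimately show ?thesis by (simp add: d)
qed

end

section \<open>Relatively bounded perturbations\<close>

text \<open>Two operators with their spectral data, whose difference has matrix entries that are small
  relative to the eigenvalues.\<close>

locale relative_perturbation = hilbert_space smul ip
  for smul :: "'k::rc_field \<Rightarrow> 'a::banach \<Rightarrow> 'a" and ip :: "'a \<Rightarrow> 'a \<Rightarrow> 'k" +
  fixes p :: enat and \<Sigma> \<Sigma>h :: "'a \<Rightarrow> 'a" and lam lamh :: "nat \<Rightarrow> real"
    and u uh :: "nat \<Rightarrow> 'a" and x :: real
  assumes \<Sigma>_bounded: "bounded_op smul \<Sigma>" and \<Sigma>_self_adjoint: "self_adjoint ip \<Sigma>"
    and \<Sigma>h_bounded: "bounded_op smul \<Sigma>h" and \<Sigma>h_self_adjoint: "self_adjoint ip \<Sigma>h"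
    and u_onb: "onb smul ip (indices p) u"
    and \<Sigma>_u: "\<And>i. i \<in> indices p \<Longrightarrow> \<Sigma> (u i) = smul (of_real (lam i)) (u i)"
    and lam_antimono: "\<And>i j. i \<in> indices p \<Longrightarrow> j \<in> indices p \<Longrightarrow> i \<le> j \<Longrightarrow> lam j \<le> lam i"
    and lam_pos: "\<And>i. i \<in> indices p \<Longrightarrow> 0 < lam i"
    and lam_summable: "lam summable_on indices p"
    and uh_orthonormal: "orthonormal ip (indices p) uh"
    and \<Sigma>h_spectral:
      "\<And>v. ((\<lambda>i. smul (of_real (lamh i)) (proj smul ip (uh i) v)) has_sum \<Sigma>h v) (indices p)"
    and lamh_antimono:
      "\<And>i j. i \<in> indices p \<Longrightarrow> j \<in> indices p \<Longrightarrow> i \<le> j \<Longrightarrow> lamh j \<le> lamh i"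
    and lamh_nonneg: "\<And>i. i \<in> indices p \<Longrightarrow> 0 \<le> lamh i"
    and x_pos: "0 < x"
    and entry_le: "\<And>i j. i \<in> indices p \<Longrightarrow> j \<in> indices p \<Longrightarrow>
      norm (ip (\<Sigma>h (u j) - \<Sigma> (u j)) (u i)) \<le> x * sqrt (lam i * lam j)"
begin

abbreviation J :: "nat set" where "J \<equiv> indices p"

definition E :: "'a \<Rightarrow> 'a" where "E v = \<Sigma>h v - \<Sigma> v"

text \<open>A weighted \<open>\<ell>\<^sup>1\<close>-norm of the coordinates. The bound on the entries of \<open>E\<close> says exactly that the
  form of \<open>E\<close> is bounded by \<open>x\<close> in this norm, and all later estimates of \<open>E\<close> go through it.\<close>

definition wnorm :: "'a \<Rightarrow> real"
  where "wnorm v = (\<Sum>\<^sub>\<infinity>l\<in>J. sqrt (lam l) * norm (ip v (u l)))"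

lemma E_linear: "E (v + w) = E v + E w" "E (smul c v) = smul c (E v)" "bounded_linear E"
proof -
  have S: "Vector_Spaces.linear smul smul \<Sigma>" "bounded_linear \<Sigma>"
    "Vector_Spaces.linear smul smul \<Sigma>h" "bounded_linear \<Sigma>h"
    using \<Sigma>_bounded \<Sigma>h_bounded by (auto simp: bounded_op_def)
  show "E (v + w) = E v + E w"
    using S by (simp add: E_def bounded_linear.linear linear_add)
  show "E (smul c v) = smul c (E v)"
    using S by (simp add: E_def linear_iff Vector_Spaces.linear_iff scale_right_diff_distrib)
  show "bounded_linear E"
    unfolding E_def using S by (intro bounded_linear_sub)
qed

lemma E_diff: "E (v - w) = E v - E w"
  using E_linear(3) by (simp add: bounded_linear.linear linear_diff)

lemma ip_\<Sigma>_u: "a \<in> J \<Longrightarrow> ip (\<Sigma> v) (u a) = of_real (lam a) * ip v (u a)"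
  using \<Sigma>_self_adjoint by (simp add: self_adjoint_def \<Sigma>_u ip_smul_right)

lemma ip_\<Sigma>h_u: "a \<in> J \<Longrightarrow> ip (\<Sigma>h v) (u a) = of_real (lam a) * ip v (u a) + ip (E v) (u a)"
  by (simp add: E_def ip_diff_left ip_\<Sigma>_u)

lemma ip_u: "i \<in> J \<Longrightarrow> j \<in> J \<Longrightarrow> ip (u i) (u j) = (if i = j then 1 else 0)"
  using onb_orthonormal[OF u_onb] by (simp add: orthonormal_def)

lemma \<Sigma>h_uh:
  assumes "j \<in> J"
  shows "\<Sigma>h (uh j) = smul (of_real (lamh j)) (uh j)"
proof -
  have "((\<lambda>i. smul (of_real (lamh i)) (proj smul ip (uh i) (uh j)))
      has_sum smul (of_real (lamh j)) (uh j)) J"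
    by (rule has_sum_finite_neutralI[of "{j}"])
       (use assms uh_orthonormal in \<open>auto simp: orthonormal_def proj_def\<close>)
  then show ?thesis using \<Sigma>h_spectral has_sum_unique by blast
qed

subsection \<open>The weighted norm in which the perturbation is small\<close>

text \<open>Cauchy-Schwarz: this is where the trace class condition enters.\<close>

lemma wnorm_summable: "(\<lambda>l. sqrt (lam l) * norm (ip v (u l))) summable_on J"
proof (rule cauchy_schwarz_infsum)
  show "(\<lambda>l. (sqrt (lam l))\<^sup>2) summable_on J"
    using lam_summable by (rule summable_on_cong[THEN iffD1, rotated]) (use lam_pos in force)
  show "(\<lambda>l. (norm (ip v (u l)))\<^sup>2) summable_on J"
    using parseval[OF u_onb] by (rule has_sum_imp_summable)
qed (use lam_pos in \<open>auto intro: less_imp_le\<close>)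

lemma wnorm_has_sum: "((\<lambda>l. sqrt (lam l) * norm (ip v (u l))) has_sum wnorm v) J"
  using wnorm_summable by (simp add: wnorm_def)

lemma wnorm_nonneg: "0 \<le> wnorm v"
  unfolding wnorm_def using lam_pos by (intro infsum_nonneg mult_nonneg_nonneg) (auto intro: less_imp_le)

lemma wnorm_add_le: "wnorm (v + w) \<le> wnorm v + wnorm w"
proof (rule has_sum_mono[OF wnorm_has_sum has_sum_add[OF wnorm_has_sum wnorm_has_sum]])
  fix l assume "l \<in> J"
  then show "sqrt (lam l) * norm (ip (v + w) (u l))
      \<le> sqrt (lam l) * norm (ip v (u l)) + sqrt (lam l) * norm (ip w (u l))"
    using lam_pos[of l] norm_triangle_ineq[of "ip v (u l)" "ip w (u l)"]
    unfolding distrib_left[symmetric] ip_add_left by (intro mult_left_mono) auto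
qed

lemma wnorm_u: "k \<in> J \<Longrightarrow> wnorm (u k) = sqrt (lam k)"
  unfolding wnorm_def
  by (intro infsumI has_sum_finite_neutralI[of "{k}"]) (auto simp: ip_u)

lemma norm_ip_E_u_le:
  assumes a: "a \<in> J"
  shows "norm (ip (E v) (u a)) \<le> x * sqrt (lam a) * wnorm v"
proof -
  have "bounded_linear (\<lambda>w. ip (E w) (u a))"
    using bounded_linear_compose[OF bounded_linear_ip_left E_linear(3)] .
  from has_sum_bounded_linear[OF this onb_expansion[OF u_onb, of v]]
  have "((\<lambda>l. ip v (u l) * ip (E (u l)) (u a)) has_sum ip (E v) (u a)) J"
    by (simp add: E_linear ip_smul_left)
  then show ?thesis
  proof (rule norm_has_sum_le)
    show "((\<lambda>l. x * sqrt (lam a) * (sqrt (lam l) * norm (ip v (u l))))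
        has_sum x * sqrt (lam a) * wnorm v) J"
      by (intro has_sum_cmult_right wnorm_has_sum)
    fix l assume "l \<in> J"
    then show "norm (ip v (u l) * ip (E (u l)) (u a))
        \<le> x * sqrt (lam a) * (sqrt (lam l) * norm (ip v (u l)))"
      using mult_left_mono[OF entry_le[OF a, of l] norm_ge_zero[of "ip v (u l)"]]
      by (simp add: norm_mult E_def real_sqrt_mult mult_ac)
  qed
qed

lemma norm_ip_E_le: "norm (ip (E v) w) \<le> x * wnorm v * wnorm w"
proof (rule norm_has_sum_le[OF parseval_ip[OF u_onb]])
  show "((\<lambda>a. x * wnorm v * (sqrt (lam a) * norm (ip w (u a)))) has_sum x * wnorm v * wnorm w) J"
    by (intro has_sum_cmult_right wnorm_has_sum)
  fix a assume "a \<in> J"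
  then show "norm (ip (E v) (u a) * ip (u a) w) \<le> x * wnorm v * (sqrt (lam a) * norm (ip w (u a)))"
    using mult_right_mono[OF norm_ip_E_u_le[of a v] norm_ge_zero[of "ip (u a) w"]]
    by (simp add: norm_mult norm_ip_commute[of w] mult_ac)
qed

subsection \<open>Relative perturbation of eigenvalues\<close>

lemma indices_down: "j \<in> J \<Longrightarrow> 1 \<le> i \<Longrightarrow> i \<le> j \<Longrightarrow> i \<in> J"
  using order_trans[of "enat i" "enat j" p] by (auto simp: indices_def)

lemma ip_\<Sigma>_self:
  assumes "((\<lambda>k. lam k * (norm (ip v (u k)))\<^sup>2) has_sum q) J"
  shows "ip (\<Sigma> v) v = of_real q"
proof -
  have "((\<lambda>k. of_real (lam k * (norm (ip v (u k)))\<^sup>2)) has_sum ip (\<Sigma> v) v) J"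
    using parseval_ip[OF u_onb, of "\<Sigma> v" v]
    by (rule has_sum_cong[THEN iffD1, rotated])
       (simp add: ip_\<Sigma>_u ip_mult_ip_swap mult.assoc del: of_real_power)
  then show ?thesis using has_sum_of_real[OF assms] has_sum_unique by blast
qed

lemma ip_\<Sigma>h_self:
  assumes "((\<lambda>k. lamh k * (norm (ip v (uh k)))\<^sup>2) has_sum q) J"
  shows "ip (\<Sigma>h v) v = of_real q"
proof -
  have "((\<lambda>k. of_real (lamh k * (norm (ip v (uh k)))\<^sup>2)) has_sum ip (\<Sigma>h v) v) J"
    using has_sum_bounded_linear[OF bounded_linear_ip_left \<Sigma>h_spectral, of v v]
    by (rule has_sum_cong[THEN iffD1, rotated])
       (simp add: proj_def ip_smul_left ip_mult_ip_swap mult.assoc del: of_real_power)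
  then show ?thesis using has_sum_of_real[OF assms] has_sum_unique by blast
qed

lemma one_le_indices: "j \<in> J \<Longrightarrow> 1 \<le> j" and one_in_indices: "j \<in> J \<Longrightarrow> 1 \<in> J"
  using indices_down[of j 1] by (auto simp: indices_def)

lemma weighted_sq_summable:
  assumes on: "orthonormal ip J b" and bd: "\<And>k. k \<in> J \<Longrightarrow> 0 \<le> f k \<and> f k \<le> C"
  shows "(\<lambda>k. f k * (norm (ip v (b k)))\<^sup>2) summable_on J"
  by (rule summable_on_comparison_test[OF summable_on_cmult_right[OF bessel_summable(1)[OF on, of v], of C]])
     (use bd in \<open>auto intro: mult_right_mono\<close>)

lemma lam_le: "k \<in> J \<Longrightarrow> lam k \<le> lam 1" and lamh_le: "k \<in> J \<Longrightarrow> lamh k \<le> lamh 1"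
  using lam_antimono[of 1 k] lamh_antimono[of 1 k] one_le_indices one_in_indices by auto

text \<open>By Cauchy-Schwarz for the weights \<open>\<bar>lam j - lam k\<bar> + y\<close>, the quadratic form of the
  perturbation is dominated by a diagonal form that turns, on the span of the \<open>u k\<close> with \<open>k \<ge> j\<close>
  (or \<open>k \<le> j\<close>), the form of \<open>\<Sigma>\<close> into multiplication by \<open>lam j + y\<close> (or \<open>lam j - y\<close>). The min-max
  principle then locates the eigenvalue.\<close>

lemma eigenvalue_perturbation:
  assumes j: "j \<in> J" and y: "0 < y"
    and summ: "(\<lambda>k. lam k / (\<bar>lam j - lam k\<bar> + y)) summable_on J"
    and small: "x * (\<Sum>\<^sub>\<infinity>k\<in>J. lam k / (\<bar>lam j - lam k\<bar> + y)) \<le> 1"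
  shows "\<bar>lamh j - lam j\<bar> \<le> y"
proof -
  define w where "w k = \<bar>lam j - lam k\<bar> + y" for k
  have w_pos: "0 < w k" for k using y by (simp add: w_def)
  have on: "orthonormal ip J u" by (rule onb_orthonormal[OF u_onb])
  have w_le: "w k \<le> lam 1 + y" if "k \<in> J" for k
    using that j lam_le[of j] lam_le[of k] lam_pos[of j] lam_pos[of k] by (auto simp: w_def)
  have summ_D: "(\<lambda>k. w k * (norm (ip v (u k)))\<^sup>2) summable_on J" for v
    by (rule weighted_sq_summable[OF on]) (use w_le w_pos in \<open>auto intro: less_imp_le\<close>)
  have summ_q: "(\<lambda>k. lam k * (norm (ip v (u k)))\<^sup>2) summable_on J" for v
    by (rule weighted_sq_summable[OF on]) (use lam_le lam_pos in \<open>auto intro: less_imp_le\<close>)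
  have summ_qh: "(\<lambda>k. lamh k * (norm (ip v (uh k)))\<^sup>2) summable_on J" for v
    by (rule weighted_sq_summable[OF uh_orthonormal]) (use lamh_le lamh_nonneg in auto)
  define D where "D v = (\<Sum>\<^sub>\<infinity>k\<in>J. w k * (norm (ip v (u k)))\<^sup>2)" for v
  define q where "q v = (\<Sum>\<^sub>\<infinity>k\<in>J. lam k * (norm (ip v (u k)))\<^sup>2)" for v
  define qh where "qh v = (\<Sum>\<^sub>\<infinity>k\<in>J. lamh k * (norm (ip v (uh k)))\<^sup>2)" for v
  have D: "((\<lambda>k. w k * (norm (ip v (u k)))\<^sup>2) has_sum D v) J" for v
    using summ_D by (simp add: D_def)
  have q: "((\<lambda>k. lam k * (norm (ip v (u k)))\<^sup>2) has_sum q v) J" for v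
    using summ_q by (simp add: q_def)
  have qh: "((\<lambda>k. lamh k * (norm (ip v (uh k)))\<^sup>2) has_sum qh v) J" for v
    using summ_qh by (simp add: qh_def)
  have form: "\<bar>qh v - q v\<bar> \<le> D v" for v
  proof -
    have sq1: "(sqrt (lam k / w k))\<^sup>2 = lam k / w k" if "k \<in> J" for k
      using lam_pos[OF that] w_pos[of k] by simp
    have sq2: "(sqrt (w k) * norm (ip v (u k)))\<^sup>2 = w k * (norm (ip v (u k)))\<^sup>2" for k
      using w_pos[of k] by (simp add: power_mult_distrib)
    have prod: "sqrt (lam k / w k) * (sqrt (w k) * norm (ip v (u k))) = sqrt (lam k) * norm (ip v (u k))" for k
      using w_pos[of k] by (simp add: real_sqrt_divide)
    have "(\<Sum>\<^sub>\<infinity>k\<in>J. sqrt (lam k / w k) * (sqrt (w k) * norm (ip v (u k))))\<^sup>2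
      \<le> (\<Sum>\<^sub>\<infinity>k\<in>J. (sqrt (lam k / w k))\<^sup>2) * (\<Sum>\<^sub>\<infinity>k\<in>J. (sqrt (w k) * norm (ip v (u k)))\<^sup>2)"
    proof (rule cauchy_schwarz_infsum)
      show "(\<lambda>k. (sqrt (lam k / w k))\<^sup>2) summable_on J"
        using summ unfolding w_def[symmetric] by (rule summable_on_cong[THEN iffD2, rotated]) (rule sq1)
    qed (use summ_D[of v] w_pos lam_pos in \<open>auto simp: sq2 intro: less_imp_le
      intro!: mult_nonneg_nonneg divide_nonneg_nonneg\<close>)
    also have "(\<Sum>\<^sub>\<infinity>k\<in>J. (sqrt (lam k / w k))\<^sup>2) = (\<Sum>\<^sub>\<infinity>k\<in>J. lam k / w k)"
      by (rule infsum_cong) (rule sq1)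
    finally have "x * (wnorm v)\<^sup>2 \<le> x * ((\<Sum>\<^sub>\<infinity>k\<in>J. lam k / w k) * D v)"
      using x_pos unfolding prod sq2 wnorm_def[symmetric] D_def[symmetric] by (intro mult_left_mono) auto
    also have "\<dots> \<le> 1 * D v"
      unfolding mult.assoc[symmetric]
      using small w_pos by (intro mult_right_mono) 
        (auto simp: D_def w_def[symmetric] intro!: infsum_nonneg mult_nonneg_nonneg
          intro: less_imp_le)
    finally have "norm (ip (E v) v) \<le> D v"
      using norm_ip_E_le[of v v] by (simp add: power2_eq_square)
    moreover have "ip (E v) v = of_real (qh v - q v)"
      using ip_\<Sigma>_self[OF q] ip_\<Sigma>h_self[OF qh] by (simp add: E_def ip_diff_left)
    ultimately show ?thesis by (metis norm_of_real)
  qed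
  have seg: "{1..j} \<subseteq> J" using j indices_down by auto
  have le_j: "k \<in> {1..j}" if "k \<in> J" "k \<le> j" for k using that by (auto simp: indices_def)
  have upper: "lamh j \<le> lam j + y"
  proof -
    \<comment> \<open>A test vector in the span of \<open>uh 1, \<dots>, uh j\<close>, orthogonal to \<open>u 1, \<dots>, u (j - 1)\<close>.\<close>
    obtain c where v0: "(\<Sum>i\<in>{1..j}. smul (c i) (uh i)) \<noteq> 0"
      and orth: "\<And>r. r \<in> {1..<j} \<Longrightarrow> ip (\<Sum>i\<in>{1..j}. smul (c i) (uh i)) (u r) = 0"
      using orthogonal_combination[OF orthonormal_subset[OF uh_orthonormal seg], of "{1..<j}" u] j
      by (auto simp: indices_def)
    define v where "v = (\<Sum>i\<in>{1..j}. smul (c i) (uh i))"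
    have on_seg: "orthonormal ip {1..j} uh" by (rule orthonormal_subset[OF uh_orthonormal seg])
    have "ip v (uh i) = c i" if "i \<in> {1..j}" for i
      unfolding v_def using that by (intro ip_lincomb_orthonormal[OF on_seg]) auto
    moreover have "(norm v)\<^sup>2 = (\<Sum>i\<in>{1..j}. (norm (c i))\<^sup>2)"
      unfolding v_def by (rule norm_lincomb_orthonormal[OF on_seg]) simp
    ultimately have vn: "(norm v)\<^sup>2 = (\<Sum>i\<in>{1..j}. (norm (ip v (uh i)))\<^sup>2)" by simp
    have "lamh j * (norm v)\<^sup>2 \<le> (\<Sum>i\<in>{1..j}. lamh i * (norm (ip v (uh i)))\<^sup>2)"
      unfolding vn sum_distrib_left
      by (intro sum_mono mult_right_mono) (use lamh_antimono j seg in auto)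
    also have "\<dots> \<le> qh v"
      by (rule finite_sum_le_has_sum[OF qh]) (use seg lamh_nonneg in auto)
    also have "\<dots> \<le> q v + D v" using form[of v] by linarith
    also have "q v + D v = (lam j + y) * (norm v)\<^sup>2"
    proof (rule has_sum_unique[OF has_sum_add[OF q D]])
      show "((\<lambda>k. lam k * (norm (ip v (u k)))\<^sup>2 + w k * (norm (ip v (u k)))\<^sup>2)
          has_sum (lam j + y) * (norm v)\<^sup>2) J"
        using has_sum_cmult_right[OF parseval[OF u_onb]]
      proof (rule has_sum_cong[THEN iffD1, rotated])
        fix k assume k: "k \<in> J"
        show "(lam j + y) * (norm (ip v (u k)))\<^sup>2
          = lam k * (norm (ip v (u k)))\<^sup>2 + w k * (norm (ip v (u k)))\<^sup>2"
        proof (cases "k < j")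
          case True
          then have "ip v (u k) = 0" using orth[of k] le_j[of k] k by (auto simp: v_def)
          then show ?thesis by simp
        next
          case False
          then have "lam k \<le> lam j" using lam_antimono[of j k] j k by simp
          then show ?thesis by (simp add: w_def algebra_simps)
        qed
      qed
    qed
    finally show ?thesis using v0 by (simp add: v_def)
  qed
  have lower: "lam j - y \<le> lamh j"
  proof -
    \<comment> \<open>A test vector in the span of \<open>u 1, \<dots>, u j\<close>, orthogonal to \<open>uh 1, \<dots>, uh (j - 1)\<close>.\<close>
    obtain c where v0: "(\<Sum>i\<in>{1..j}. smul (c i) (u i)) \<noteq> 0"
      and orth: "\<And>r. r \<in> {1..<j} \<Longrightarrow> ip (\<Sum>i\<in>{1..j}. smul (c i) (u i)) (uh r) = 0"
      using orthogonal_combination[OF orthonormal_subset[OF on seg], of "{1..<j}" uh] j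
      by (auto simp: indices_def)
    define v where "v = (\<Sum>i\<in>{1..j}. smul (c i) (u i))"
    have v_high: "ip v (u k) = 0" if "k \<in> J" "k > j" for k
      unfolding v_def ip_sum_left ip_smul_left
      by (intro sum.neutral) (use that seg in \<open>auto simp: ip_u\<close>)
    have "(lam j - y) * (norm v)\<^sup>2 = q v - D v"
    proof (rule has_sum_unique)
      show "((\<lambda>k. lam k * (norm (ip v (u k)))\<^sup>2 - w k * (norm (ip v (u k)))\<^sup>2) has_sum q v - D v) J"
        using has_sum_add[OF q has_sum_uminusI[OF D]] by simp
      show "((\<lambda>k. lam k * (norm (ip v (u k)))\<^sup>2 - w k * (norm (ip v (u k)))\<^sup>2)
          has_sum (lam j - y) * (norm v)\<^sup>2) J"
        using has_sum_cmult_right[OF parseval[OF u_onb]]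
      proof (rule has_sum_cong[THEN iffD1, rotated])
        fix k assume k: "k \<in> J"
        show "(lam j - y) * (norm (ip v (u k)))\<^sup>2
          = lam k * (norm (ip v (u k)))\<^sup>2 - w k * (norm (ip v (u k)))\<^sup>2"
        proof (cases "j < k")
          case True
          then show ?thesis using v_high[of k] k by simp
        next
          case False
          then have "lam j \<le> lam k" using lam_antimono[of k j] j k by simp
          then show ?thesis by (simp add: w_def algebra_simps)
        qed
      qed
    qed
    also have "\<dots> \<le> qh v" using form[of v] by linarith
    also have "\<dots> \<le> lamh j * (\<Sum>\<^sub>\<infinity>i\<in>J. (norm (ip v (uh i)))\<^sup>2)"
    proof (rule has_sum_mono[OF qh has_sum_cmult_right[OF has_sum_infsum]])
      show "(\<lambda>i. (norm (ip v (uh i)))\<^sup>2) summable_on J" by (rule bessel_summable[OF uh_orthonormal])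
      fix i assume i: "i \<in> J"
      show "lamh i * (norm (ip v (uh i)))\<^sup>2 \<le> lamh j * (norm (ip v (uh i)))\<^sup>2"
      proof (cases "i < j")
        case True
        then have "ip v (uh i) = 0" using orth[of i] le_j[of i] i by (auto simp: v_def)
        then show ?thesis by simp
      next
        case False
        then show ?thesis using lamh_antimono[of j i] i j by (intro mult_right_mono) auto
      qed
    qed
    also have "\<dots> \<le> lamh j * (norm v)\<^sup>2"
      using lamh_nonneg[OF j] by (intro mult_left_mono bessel_summable[OF uh_orthonormal])
    finally show ?thesis using v0 by (simp add: v_def)
  qed
  show ?thesis using upper lower by linarith
qed

end

section \<open>Perturbation of an isolated group of eigenvalues\<close>

text \<open>The number \<open>gap j\<close> is the distance from \<open>lam j\<close> to the \<open>lam i\<close> with \<open>i \<in> I\<close>, for \<open>j\<close> outside \<open>I\<close>. The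
  last condition weakens the one on the relative rank: in the terms for \<open>i \<in> I\<close>, the minimum over
  \<open>j\<close> is replaced by one arbitrary \<open>j\<close>. In this form it has no infinite values and no minimum over an
  infinite set.\<close>

locale separated_perturbation = relative_perturbation smul ip p \<Sigma> \<Sigma>h lam lamh u uh x
  for smul :: "'k::rc_field \<Rightarrow> 'a::banach \<Rightarrow> 'a" and ip :: "'a \<Rightarrow> 'a \<Rightarrow> 'k"
    and p :: enat and \<Sigma> \<Sigma>h :: "'a \<Rightarrow> 'a" and lam lamh :: "nat \<Rightarrow> real"
    and u uh :: "nat \<Rightarrow> 'a" and x :: real +
  fixes I :: "nat set" and gap :: "nat \<Rightarrow> real"
  assumes I_finite: "finite I" and I_subset: "I \<subseteq> J"
    and gap_pos: "\<And>j. j \<in> J - I \<Longrightarrow> 0 < gap j"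
    and gap_le: "\<And>i j. j \<in> J - I \<Longrightarrow> i \<in> I \<Longrightarrow> gap j \<le> \<bar>lam j - lam i\<bar>"
    and gap_attained: "\<And>j. j \<in> J - I \<Longrightarrow> \<exists>i\<in>I. gap j = \<bar>lam j - lam i\<bar>"
    and gap_summable: "(\<lambda>l. lam l / gap l) summable_on J - I"
    and rank_le: "\<And>j. j \<in> J - I \<Longrightarrow>
      (\<Sum>i\<in>I. lam i / \<bar>lam i - lam j\<bar>) + (\<Sum>\<^sub>\<infinity>l\<in>J - I. lam l / gap l) \<le> 1 / (8 * x)"
begin

lemma lam_neq: "i \<in> I \<Longrightarrow> j \<in> J - I \<Longrightarrow> lam i \<noteq> lam j"
  using gap_pos[of j] gap_le[of j i] by auto

lemma lam_pos_I: "i \<in> I \<Longrightarrow> 0 < lam i" and lam_pos_compl: "j \<in> J - I \<Longrightarrow> 0 < lam j"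
  using lam_pos I_subset by auto

text \<open>The relative rank enters the fixed point argument only through this bound, for a column, and
  the next, for a row.\<close>

lemma column_rank_le:
  assumes "l \<in> J - I"
  shows "x * (\<Sum>m\<in>I. lam m / \<bar>lam l - lam m\<bar>) \<le> 1 / 8"
proof -
  have "0 \<le> (\<Sum>\<^sub>\<infinity>l\<in>J - I. lam l / gap l)"
    using lam_pos gap_pos by (intro infsum_nonneg) (auto intro!: divide_nonneg_nonneg less_imp_le)
  then have "(\<Sum>m\<in>I. lam m / \<bar>lam l - lam m\<bar>) \<le> 1 / (8 * x)"
    using rank_le[OF assms] by (simp add: abs_minus_commute)
  from mult_left_mono[OF this, of x] show ?thesis using x_pos by simp
qed

lemma row_rank:
  assumes k: "k \<in> I"
  shows "(\<lambda>l. lam l / \<bar>lam l - lam k\<bar>) summable_on J - I"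
    and "x * (\<Sum>\<^sub>\<infinity>l\<in>J - I. lam l / \<bar>lam l - lam k\<bar>) \<le> 1 / 8"
proof -
  have le: "lam l / \<bar>lam l - lam k\<bar> \<le> lam l / gap l" if "l \<in> J - I" for l
    using that k gap_le gap_pos lam_pos by (intro divide_left_mono) (auto intro: less_imp_le dest: lam_neq)
  show summ: "(\<lambda>l. lam l / \<bar>lam l - lam k\<bar>) summable_on J - I"
    by (rule summable_on_comparison_test[OF gap_summable]) (use le lam_pos in \<open>auto intro: less_imp_le\<close>)
  have "(\<Sum>\<^sub>\<infinity>l\<in>J - I. lam l / \<bar>lam l - lam k\<bar>) \<le> 1 / (8 * x)"
  proof (cases "J - I = {}")
    case True
    then show ?thesis using x_pos by (simp only: infsum_empty) simp
  next
    case False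
    then obtain j where j: "j \<in> J - I" by blast
    have "(\<Sum>\<^sub>\<infinity>l\<in>J - I. lam l / \<bar>lam l - lam k\<bar>) \<le> (\<Sum>\<^sub>\<infinity>l\<in>J - I. lam l / gap l)"
      by (rule infsum_mono[OF summ gap_summable le])
    moreover have "0 \<le> (\<Sum>i\<in>I. lam i / \<bar>lam i - lam j\<bar>)"
      using lam_pos_I by (intro sum_nonneg) (auto intro: less_imp_le)
    ultimately show ?thesis using rank_le[OF j] by linarith
  qed
  from mult_left_mono[OF this, of x] show "x * (\<Sum>\<^sub>\<infinity>l\<in>J - I. lam l / \<bar>lam l - lam k\<bar>) \<le> 1 / 8"
    using x_pos by simp
qed

text \<open>The weights of the Cauchy-Schwarz argument are compared with the terms of the relative rank:
  for \<open>i \<in> I\<close> directly, and for \<open>l\<close> outside \<open>I\<close> because the distance to a set is 1-Lipschitz. The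
  factor 2 lost there is affordable.\<close>

lemma eigenvalue_compl:
  assumes j: "j \<in> J - I"
  shows "\<bar>lamh j - lam j\<bar> \<le> gap j / 2"
proof (rule eigenvalue_perturbation)
  let ?t = "\<lambda>k. lam k / (\<bar>lam j - lam k\<bar> + gap j / 2)"
  have inn: "?t i \<le> 2 * (lam i / \<bar>lam i - lam j\<bar>)" if i: "i \<in> I" for i
  proof -
    have "lam i / (\<bar>lam j - lam i\<bar> + gap j / 2) \<le> lam i / (\<bar>lam i - lam j\<bar> / 2)"
      using gap_pos[OF j] lam_pos_I[OF i] lam_neq[OF i j] by (intro divide_left_mono) (auto simp: abs_minus_commute)
    then show ?thesis by (simp add: mult.commute)
  qed
  have out: "?t l \<le> 2 * (lam l / gap l)" if l: "l \<in> J - I" for l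
  proof -
    obtain i where i: "i \<in> I" "gap j = \<bar>lam j - lam i\<bar>" using gap_attained[OF j] by blast
    have "gap l \<le> \<bar>lam j - lam l\<bar> + gap j"
      using gap_le[OF l i(1)] i(2) by linarith
    then have "gap l / 2 \<le> \<bar>lam j - lam l\<bar> + gap j / 2" by linarith
    then have "lam l / (\<bar>lam j - lam l\<bar> + gap j / 2) \<le> lam l / (gap l / 2)"
      using gap_pos[OF j] gap_pos[OF l] lam_pos_compl[OF l] by (intro divide_left_mono) auto
    then show ?thesis by (simp add: mult.commute)
  qed
  have t_nonneg: "0 \<le> ?t k" if "k \<in> J" for k
    using lam_pos[OF that] gap_pos[OF j] by simp
  have summ: "?t summable_on J - I"
    by (rule summable_on_comparison_test[OF summable_on_cmult_right[OF gap_summable, of 2]])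
       (use out t_nonneg in auto)
  have J: "J = I \<union> (J - I)" using I_subset by auto
  have "?t summable_on I \<union> (J - I)"
    using summ I_finite by (intro summable_on_Un_disjoint) auto
  then show "?t summable_on J" using J by simp
  have "(\<Sum>\<^sub>\<infinity>k\<in>J. ?t k) = (\<Sum>\<^sub>\<infinity>k\<in>I \<union> (J - I). ?t k)" using J by simp
  also have "\<dots> = (\<Sum>k\<in>I. ?t k) + (\<Sum>\<^sub>\<infinity>k\<in>J - I. ?t k)"
    using summ I_finite by (subst infsum_Un_disjoint) auto
  also have "\<dots> \<le> (\<Sum>i\<in>I. 2 * (lam i / \<bar>lam i - lam j\<bar>)) + (\<Sum>\<^sub>\<infinity>l\<in>J - I. 2 * (lam l / gap l))"
    by (intro add_mono sum_mono infsum_mono summ summable_on_cmult_right gap_summable inn out)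
  also have "\<dots> = 2 * ((\<Sum>i\<in>I. lam i / \<bar>lam i - lam j\<bar>) + (\<Sum>\<^sub>\<infinity>l\<in>J - I. lam l / gap l))"
    unfolding sum_distrib_left[symmetric] using gap_summable by (subst infsum_cmult_right) auto
  also have "\<dots> \<le> 2 * (1 / (8 * x))"
    using rank_le[OF j] by (intro mult_left_mono) auto
  finally have "x * (\<Sum>\<^sub>\<infinity>k\<in>J. ?t k) \<le> x * (2 * (1 / (8 * x)))"
    using x_pos by (intro mult_left_mono) auto
  then show "x * (\<Sum>\<^sub>\<infinity>k\<in>J. ?t k) \<le> 1" using x_pos by simp
qed (use j gap_pos in auto)

subsection \<open>The invariant subspace as a graph\<close>

text \<open>The size that first-order perturbation theory allows for the coordinate of the \<open>k\<close>-th
  perturbed vector along \<open>u l\<close>.\<close>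

definition first_order_size :: "nat \<Rightarrow> nat \<Rightarrow> real"
  where "first_order_size l k = x * sqrt (lam l * lam k) / \<bar>lam l - lam k\<bar>"

definition dominated :: "real \<Rightarrow> (nat \<Rightarrow> 'a) \<Rightarrow> bool"
  where "dominated d z \<longleftrightarrow> (\<forall>k\<in>I. (\<forall>i\<in>I. ip (z k) (u i) = 0) \<and>
    (\<forall>l\<in>J - I. norm (ip (z k) (u l)) \<le> d * first_order_size l k))"

text \<open>The Riccati equation for an invariant graph, solved for its linear diagonal part.\<close>

definition graph_step :: "(nat \<Rightarrow> 'a) \<Rightarrow> nat \<Rightarrow> nat \<Rightarrow> 'k"
  where "graph_step z k l =
    (ip (E (u k + z k)) (u l) - (\<Sum>m\<in>I. ip (z m) (u l) * ip (E (u k + z k)) (u m)))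
      / of_real (lam k - lam l)"

definition graph_solution :: "(nat \<Rightarrow> 'a) \<Rightarrow> bool"
  where "graph_solution z \<longleftrightarrow>
    dominated 2 z \<and> (\<forall>k\<in>I. \<forall>l\<in>J - I. ip (z k) (u l) = graph_step z k l)"

lemma first_order_size_nonneg: "0 \<le> first_order_size l k" if "k \<in> I" "l \<in> J - I"
  using x_pos lam_pos_I[OF that(1)] lam_pos_compl[OF that(2)] by (simp add: first_order_size_def)

lemma first_order_size_sq: "l \<in> J - I \<Longrightarrow> k \<in> I \<Longrightarrow>
    (first_order_size l k)\<^sup>2 = x\<^sup>2 * (lam k * lam l / (lam k - lam l)\<^sup>2)"
  using lam_pos_I[of k] lam_pos_compl[of l]
  by (simp add: first_order_size_def power_mult_distrib power_divide power2_commute mult.commute)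

text \<open>One factor of the square is absorbed by the column bound, the other is summed by the row
  bound.\<close>

lemma first_order_size_sq_summable:
  assumes k: "k \<in> I"
  shows "(\<lambda>l. (first_order_size l k)\<^sup>2) summable_on J - I"
proof (rule summable_on_comparison_test[OF summable_on_cmult_right[OF row_rank(1)[OF k], of "x / 8"]])
  fix l assume l: "l \<in> J - I"
  have "x * (lam k / \<bar>lam l - lam k\<bar>) \<le> x * (\<Sum>m\<in>I. lam m / \<bar>lam l - lam m\<bar>)"
    using x_pos k I_finite lam_pos_I
    by (intro mult_left_mono member_le_sum) (auto intro: less_imp_le)
  also have "\<dots> \<le> 1 / 8" by (rule column_rank_le[OF l])
  finally have "x * (lam k / \<bar>lam l - lam k\<bar>) \<le> 1 / 8" .
  from mult_left_mono[OF this, of "x * (lam l / \<bar>lam l - lam k\<bar>)"]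
  have "(x * (lam l / \<bar>lam l - lam k\<bar>)) * (x * (lam k / \<bar>lam l - lam k\<bar>))
      \<le> x / 8 * (lam l / \<bar>lam l - lam k\<bar>)"
    using x_pos lam_pos_compl[OF l] by simp
  moreover have "\<bar>lam l - lam k\<bar> * \<bar>lam l - lam k\<bar> = (lam k - lam l)\<^sup>2"
    by (simp add: power2_eq_square algebra_simps)
  ultimately show "(first_order_size l k)\<^sup>2 \<le> x / 8 * (lam l / \<bar>lam l - lam k\<bar>)"
    unfolding first_order_size_sq[OF l k] by (simp add: power2_eq_square mult_ac)
qed simp

text \<open>The two weights \<open>sqrt (lam l)\<close>, one from the norm and one from \<open>first_order_size\<close>, combine to a term of
  the relative rank.\<close>

lemma wnorm_dominated:
  assumes d: "0 \<le> d" and z: "dominated d z" and k: "k \<in> I"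
  shows "wnorm (z k) \<le> d / 8 * sqrt (lam k)"
proof -
  have out: "sqrt (lam l) * norm (ip (z k) (u l)) \<le> d * x * sqrt (lam k) * (lam l / \<bar>lam l - lam k\<bar>)"
    if l: "l \<in> J - I" for l
  proof -
    have "sqrt (lam l) * norm (ip (z k) (u l)) \<le> sqrt (lam l) * (d * first_order_size l k)"
      using z l k lam_pos_compl[OF l] by (intro mult_left_mono) (auto simp: dominated_def)
    also have "\<dots> = d * x * sqrt (lam k) * ((sqrt (lam l))\<^sup>2 / \<bar>lam l - lam k\<bar>)"
      by (simp add: first_order_size_def real_sqrt_mult power2_eq_square)
    finally show ?thesis using lam_pos_compl[OF l] by simp
  qed
  have "wnorm (z k) \<le> (\<Sum>\<^sub>\<infinity>l\<in>J - I. d * x * sqrt (lam k) * (lam l / \<bar>lam l - lam k\<bar>))"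
    unfolding wnorm_def
    by (rule infsum_mono_neutral[OF wnorm_summable summable_on_cmult_right[OF row_rank(1)[OF k]]])
       (use out z k I_subset in \<open>auto simp: dominated_def\<close>)
  also have "\<dots> = d * sqrt (lam k) * (x * (\<Sum>\<^sub>\<infinity>l\<in>J - I. lam l / \<bar>lam l - lam k\<bar>))"
    using row_rank(1)[OF k] by (subst infsum_cmult_right) auto
  also have "\<dots> \<le> d * sqrt (lam k) * (1 / 8)"
    using d lam_pos_I[OF k] row_rank(2)[OF k] by (intro mult_left_mono) auto
  finally show ?thesis by simp
qed

lemma wnorm_graph_le:
  assumes "0 \<le> d" "dominated d z" "k \<in> I"
  shows "wnorm (u k + z k) \<le> (1 + d / 8) * sqrt (lam k)"
  using wnorm_add_le[of "u k" "z k"] wnorm_dominated[OF assms] wnorm_u[of k] assms(3) I_subset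
  by (auto simp: algebra_simps)

text \<open>The same pairing of square roots, for the products with the finitely many \<open>z m\<close>.\<close>

lemma column_sum_le:
  assumes d: "0 \<le> d" and z: "dominated d z" and l: "l \<in> J - I"
    and e: "\<And>m. m \<in> I \<Longrightarrow> norm (e m) \<le> x * sqrt (lam m) * c" and c: "0 \<le> c"
  shows "norm (\<Sum>m\<in>I. ip (z m) (u l) * e m) \<le> d / 8 * (x * sqrt (lam l) * c)"
proof -
  have "norm (ip (z m) (u l) * e m) \<le> d * x * sqrt (lam l) * c * (x * (lam m / \<bar>lam l - lam m\<bar>))"
    if m: "m \<in> I" for m
  proof -
    have "norm (ip (z m) (u l) * e m) \<le> (d * first_order_size l m) * (x * sqrt (lam m) * c)"
      unfolding norm_mult using z m l d first_order_size_nonneg[OF m l]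
      by (intro mult_mono e) (auto simp: dominated_def)
    also have "\<dots> = d * x * sqrt (lam l) * c * (x * ((sqrt (lam m))\<^sup>2 / \<bar>lam l - lam m\<bar>))"
      by (simp add: first_order_size_def real_sqrt_mult power2_eq_square)
    finally show ?thesis using lam_pos_I[OF m] by simp
  qed
  then have "norm (\<Sum>m\<in>I. ip (z m) (u l) * e m)
      \<le> (\<Sum>m\<in>I. d * x * sqrt (lam l) * c * (x * (lam m / \<bar>lam l - lam m\<bar>)))"
    by (rule sum_norm_le)
  also have "\<dots> = d * x * sqrt (lam l) * c * (x * (\<Sum>m\<in>I. lam m / \<bar>lam l - lam m\<bar>))"
    by (simp add: sum_distrib_left)
  also have "\<dots> \<le> d * x * sqrt (lam l) * c * (1 / 8)"
    using d x_pos lam_pos_compl[OF l] c column_rank_le[OF l] by (intro mult_left_mono) auto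
  finally show ?thesis by simp
qed

lemma norm_divide_gap_le:
  fixes a :: 'k
  assumes "norm a \<le> c * (x * sqrt (lam l) * sqrt (lam k))"
  shows "norm (a / of_real (lam k - lam l)) \<le> c * first_order_size l k"
  using divide_right_mono[OF assms, of "\<bar>lam k - lam l\<bar>"]
  unfolding norm_divide norm_of_real
  by (simp add: first_order_size_def real_sqrt_mult mult_ac abs_minus_commute)

lemma mult_wnorm_le: "0 \<le> c \<Longrightarrow> wnorm v \<le> a * sqrt (lam k) \<Longrightarrow> l \<in> J \<Longrightarrow>
    c * (x * sqrt (lam l) * wnorm v) \<le> c * a * (x * sqrt (lam l) * sqrt (lam k))"
  using mult_left_mono[of "wnorm v" "a * sqrt (lam k)" "c * (x * sqrt (lam l))"] x_pos lam_pos[of l]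
  by (simp add: mult_ac)

text \<open>The norm of \<open>u k + z k\<close> and the sum over \<open>m\<close> contribute a factor
  \<open>1 + 2 / 8\<close> each, and the square of \<open>5 / 4\<close> is below 2.\<close>

lemma graph_step_bound:
  assumes z: "dominated 2 z" and k: "k \<in> I" and l: "l \<in> J - I"
  shows "norm (graph_step z k l) \<le> 2 * first_order_size l k"
proof -
  let ?v = "u k + z k"
  have lJ: "l \<in> J" and I: "\<And>m. m \<in> I \<Longrightarrow> m \<in> J" using l I_subset by auto
  have "norm (ip (E ?v) (u l) - (\<Sum>m\<in>I. ip (z m) (u l) * ip (E ?v) (u m)))
      \<le> x * sqrt (lam l) * wnorm ?v + 2 / 8 * (x * sqrt (lam l) * wnorm ?v)"
    by (intro order_trans[OF norm_triangle_ineq4] add_mono norm_ip_E_u_le lJ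
        column_sum_le[OF _ z l] wnorm_nonneg) (auto intro: I)
  also have "\<dots> = 5 / 4 * (x * sqrt (lam l) * wnorm ?v)" by simp
  also have "\<dots> \<le> 5 / 4 * (1 + 2 / 8) * (x * sqrt (lam l) * sqrt (lam k))"
    by (rule mult_wnorm_le[OF _ wnorm_graph_le[OF _ z k] lJ]) auto
  also have "\<dots> \<le> 2 * (x * sqrt (lam l) * sqrt (lam k))"
    using x_pos lam_pos[OF lJ] lam_pos_I[OF k] by simp
  finally show ?thesis unfolding graph_step_def by (rule norm_divide_gap_le)
qed

text \<open>The step is a quadratic polynomial in \<open>z\<close>; its difference quotient is at most
  \<open>1 / 8 + 5 / 32 + 1 / 32\<close>.\<close>

lemma graph_step_contraction:
  assumes z: "dominated 2 z" and z': "dominated 2 z'"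
    and d: "0 \<le> d" and diff: "dominated d (\<lambda>k. z k - z' k)"
    and k: "k \<in> I" and l: "l \<in> J - I"
  shows "norm (graph_step z k l - graph_step z' k l) \<le> d / 2 * first_order_size l k"
proof -
  let ?v = "u k + z k" and ?w = "z k - z' k"
  have lJ: "l \<in> J" and I: "\<And>m. m \<in> I \<Longrightarrow> m \<in> J" using l I_subset by auto
  \<comment> \<open>The product of \<open>z m\<close> and \<open>E\<close> is differenced one factor at a time: \<open>b\<close> and \<open>c\<close>.\<close>
  define a where "a = ip (E ?w) (u l)"
  define b where "b = (\<Sum>m\<in>I. ip (z m - z' m) (u l) * ip (E ?v) (u m))"
  define c where "c = (\<Sum>m\<in>I. ip (z' m) (u l) * ip (E ?w) (u m))"
  have E_eq: "ip (E (u k + z' k)) e = ip (E ?v) e - ip (E ?w) e" for e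
  proof -
    have "u k + z' k = ?v - ?w" by simp
    then show ?thesis by (metis E_diff ip_diff_left)
  qed
  have split: "graph_step z k l - graph_step z' k l = (a - b - c) / of_real (lam k - lam l)"
    unfolding graph_step_def diff_divide_distrib[symmetric] E_eq a_def b_def c_def
    by (rule arg_cong[of _ _ "\<lambda>t. t / _"])
       (simp add: ip_diff_left left_diff_distrib right_diff_distrib sum_subtractf)
  have "norm a \<le> 1 * (x * sqrt (lam l) * wnorm ?w)"
    unfolding a_def using norm_ip_E_u_le[OF lJ] by simp
  also have "\<dots> \<le> 1 * (d / 8) * (x * sqrt (lam l) * sqrt (lam k))"
    by (rule mult_wnorm_le[OF _ wnorm_dominated[OF d diff k] lJ]) auto
  finally have a: "norm a \<le> d / 8 * (x * sqrt (lam l) * sqrt (lam k))" by simp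
  have "norm b \<le> d / 8 * (x * sqrt (lam l) * wnorm ?v)"
    unfolding b_def
    by (intro column_sum_le[OF d diff l] wnorm_nonneg norm_ip_E_u_le I)
  also have "\<dots> \<le> d / 8 * (1 + 2 / 8) * (x * sqrt (lam l) * sqrt (lam k))"
    using d by (intro mult_wnorm_le[OF _ wnorm_graph_le[OF _ z k] lJ]) auto
  finally have b: "norm b \<le> d / 8 * (5 / 4) * (x * sqrt (lam l) * sqrt (lam k))" by simp
  have "norm c \<le> 2 / 8 * (x * sqrt (lam l) * wnorm ?w)"
    unfolding c_def
    by (intro column_sum_le[OF _ z' l] wnorm_nonneg norm_ip_E_u_le I) auto
  also have "\<dots> \<le> 2 / 8 * (d / 8) * (x * sqrt (lam l) * sqrt (lam k))"
    by (rule mult_wnorm_le[OF _ wnorm_dominated[OF d diff k] lJ]) auto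
  finally have c: "norm c \<le> 2 / 8 * (d / 8) * (x * sqrt (lam l) * sqrt (lam k))" .
  have "norm (a - b - c) \<le> norm a + norm b + norm c"
    using norm_triangle_ineq4[of "a - b" c] norm_triangle_ineq4[of a b] by linarith
  also have "\<dots> \<le> (d / 8 + d / 8 * (5 / 4) + 2 / 8 * (d / 8)) * (x * sqrt (lam l) * sqrt (lam k))"
    using a b c by (simp only: distrib_right)
  also have "\<dots> \<le> d / 2 * (x * sqrt (lam l) * sqrt (lam k))"
    using d x_pos lam_pos[OF lJ] lam_pos_I[OF k] by (intro mult_right_mono) auto
  finally show ?thesis unfolding split by (rule norm_divide_gap_le)
qed

lemma vector_of_coordinates:
  assumes bd: "\<And>l. l \<in> J - I \<Longrightarrow> norm (f l) \<le> d * first_order_size l k" and k: "k \<in> I"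
  shows "\<exists>v. (\<forall>i\<in>I. ip v (u i) = 0) \<and> (\<forall>l\<in>J - I. ip v (u l) = f l)"
proof -
  define c where "c l = (if l \<in> I then 0 else f l)" for l
  have "(\<lambda>l. (norm (f l))\<^sup>2) summable_on J - I"
  proof (rule summable_on_comparison_test
      [OF summable_on_cmult_right[OF first_order_size_sq_summable[OF k], of "d\<^sup>2"]])
    fix l assume l: "l \<in> J - I"
    show "(norm (f l))\<^sup>2 \<le> d\<^sup>2 * (first_order_size l k)\<^sup>2"
      using power_mono[OF bd[OF l] norm_ge_zero, of 2] by (simp add: power_mult_distrib)
  qed simp
  then have "(\<lambda>l. (norm (c l))\<^sup>2) summable_on J"
    by (rule summable_on_cong_neutral[THEN iffD1, rotated -1]) (use I_subset in \<open>auto simp: c_def\<close>)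
  from riesz_fischer[OF onb_orthonormal[OF u_onb] this] obtain v
    where "\<And>j. j \<in> J \<Longrightarrow> ip v (u j) = c j" by metis
  then show ?thesis using I_subset by (intro exI[of _ v]) (auto simp: c_def)
qed

lemma dominated_norm_sq_le:
  assumes z: "dominated d z" and k: "k \<in> I"
  shows "(norm (z k))\<^sup>2 \<le> d\<^sup>2 * (\<Sum>\<^sub>\<infinity>l\<in>J - I. (first_order_size l k)\<^sup>2)"
proof (rule has_sum_mono_neutral[OF parseval[OF u_onb]])
  show "((\<lambda>l. d\<^sup>2 * (first_order_size l k)\<^sup>2) has_sum d\<^sup>2 * (\<Sum>\<^sub>\<infinity>l\<in>J - I. (first_order_size l k)\<^sup>2)) (J - I)"
    by (intro has_sum_cmult_right has_sum_infsum first_order_size_sq_summable k)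
  show "(norm (ip (z k) (u l)))\<^sup>2 \<le> d\<^sup>2 * (first_order_size l k)\<^sup>2" if "l \<in> J \<inter> (J - I)" for l
    using z k that power_mono[of "norm (ip (z k) (u l))" "d * first_order_size l k" 2]
    by (auto simp: dominated_def power_mult_distrib)
qed (use z k in \<open>auto simp: dominated_def\<close>)

text \<open>The iteration runs in the Hilbert space, not on the coefficients: geometric decay of the
  increments entry by entry gives norm convergence by Parseval, and the step is continuous in \<open>z\<close>.\<close>

lemma graph_fixed_point:
  obtains z where "graph_solution z"
proof -
  define T where "T z k = (SOME v. (\<forall>i\<in>I. ip v (u i) = 0) \<and>
    (\<forall>l\<in>J - I. ip v (u l) = graph_step z k l))" for z k
  have T: "(\<forall>i\<in>I. ip (T z k) (u i) = 0) \<and> (\<forall>l\<in>J - I. ip (T z k) (u l) = graph_step z k l)"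
    if "dominated 2 z" "k \<in> I" for z k
    unfolding T_def
    by (rule someI_ex[OF vector_of_coordinates[OF graph_step_bound[OF that] that(2)]])
  define Z where "Z n = (T ^^ n) (\<lambda>_. 0)" for n
  have Z_Suc: "Z (Suc n) = T (Z n)" for n by (simp add: Z_def)
  have dom: "dominated 2 (Z n)" for n
  proof (induction n)
    case 0
    then show ?case using first_order_size_nonneg by (auto simp: Z_def dominated_def)
  next
    case (Suc n)
    then show ?case unfolding Z_Suc dominated_def using T[OF Suc] graph_step_bound[OF Suc] by auto
  qed
  have step: "dominated (2 * (1 / 2) ^ n) (\<lambda>k. Z (Suc n) k - Z n k)" for n
  proof (induction n)
    case 0
    then show ?case using dom[of 1] by (simp add: Z_def)
  next
    case (Suc n)
    have "norm (ip (Z (Suc (Suc n)) k - Z (Suc n) k) (u l)) \<le> 2 * (1 / 2) ^ Suc n * first_order_size l k"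
      if "k \<in> I" "l \<in> J - I" for k l
      using graph_step_contraction[OF dom[of "Suc n"] dom[of n] _ Suc that] T[OF dom[of "Suc n"] that(1)]
        T[OF dom[of n] that(1)] that(2)
      by (simp add: Z_Suc[symmetric] ip_diff_left)
    moreover have "ip (Z (Suc (Suc n)) k - Z (Suc n) k) (u i) = 0" if "k \<in> I" "i \<in> I" for k i
      using dom[of "Suc (Suc n)"] dom[of "Suc n"] that by (simp add: dominated_def ip_diff_left)
    ultimately show ?case by (simp add: dominated_def)
  qed
  have "convergent (\<lambda>n. Z n k)" if k: "k \<in> I" for k
  proof -
    define S where "S = sqrt (\<Sum>\<^sub>\<infinity>l\<in>J - I. (first_order_size l k)\<^sup>2)"
    have bd: "norm (Z (Suc n) k - Z n k) \<le> 2 * S * (1 / 2) ^ n" for n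
    proof -
      have "norm (Z (Suc n) k - Z n k) \<le> sqrt ((2 * (1 / 2) ^ n)\<^sup>2 * (\<Sum>\<^sub>\<infinity>l\<in>J - I. (first_order_size l k)\<^sup>2))"
        by (rule real_le_rsqrt[OF dominated_norm_sq_le[OF step k]])
      then show ?thesis by (simp add: real_sqrt_mult S_def mult_ac)
    qed
    have "summable (\<lambda>n. 2 * S * (1 / 2 :: real) ^ n)"
      by (intro summable_mult summable_geometric) simp
    then have "summable (\<lambda>n. Z (Suc n) k - Z n k)"
      using bd by (rule summable_comparison_test')
    then obtain s where "(\<lambda>n. \<Sum>i<n. Z (Suc i) k - Z i k) \<longlonglongrightarrow> s"
      by (auto simp: summable_def sums_def)
    then have "(\<lambda>n. Z n k - Z 0 k) \<longlonglongrightarrow> s"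
      unfolding sum_lessThan_telescope[of "\<lambda>i. Z i k"] .
    from tendsto_add[OF this tendsto_const[of "Z 0 k"]] show ?thesis
      by (auto simp: convergent_def)
  qed
  then obtain z where z: "\<And>k. k \<in> I \<Longrightarrow> (\<lambda>n. Z n k) \<longlonglongrightarrow> z k"
    unfolding convergent_def by metis
  have ip_lim: "(\<lambda>n. ip (Z n k) w) \<longlonglongrightarrow> ip (z k) w" if "k \<in> I" for k w
    by (rule bounded_linear.tendsto[OF bounded_linear_ip_left z[OF that]])
  have E_lim: "(\<lambda>n. ip (E (u k + Z n k)) w) \<longlonglongrightarrow> ip (E (u k + z k)) w" if "k \<in> I" for k w
    by (intro bounded_linear.tendsto[OF bounded_linear_ip_left]
        bounded_linear.tendsto[OF E_linear(3)] tendsto_intros z that)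
  have "dominated 2 z"
    unfolding dominated_def
  proof (intro ballI conjI)
    fix k i assume "k \<in> I" "i \<in> I"
    then have "(\<lambda>n. 0) \<longlonglongrightarrow> ip (z k) (u i)"
      using ip_lim[of k "u i"] dom by (simp add: dominated_def)
    then show "ip (z k) (u i) = 0" by (simp add: LIMSEQ_const_iff)
  next
    fix k l assume "k \<in> I" "l \<in> J - I"
    then show "norm (ip (z k) (u l)) \<le> 2 * first_order_size l k"
      using dom by (intro tendsto_upperbound[OF tendsto_norm[OF ip_lim]]) (auto simp: dominated_def)
  qed
  moreover have "ip (z k) (u l) = graph_step z k l" if kl: "k \<in> I" "l \<in> J - I" for k l
  proof -
    have "(\<lambda>n. graph_step (Z n) k l) \<longlonglongrightarrow> graph_step z k l"
      unfolding graph_step_def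
      by (intro tendsto_intros ip_lim E_lim kl) (use lam_neq[OF kl] in auto)
    moreover have "(\<lambda>n. graph_step (Z n) k l) \<longlonglongrightarrow> ip (z k) (u l)"
      using LIMSEQ_Suc[OF ip_lim[OF kl(1), of "u l"]] T[OF dom kl(1)] kl(2)
      by (simp add: Z_Suc)
    ultimately show ?thesis using LIMSEQ_unique by blast
  qed
  ultimately have "graph_solution z" by (simp add: graph_solution_def)
  then show ?thesis by (rule that)
qed

subsection \<open>The graph is orthogonal to the other eigenvectors\<close>

text \<open>Along \<open>u a\<close> with \<open>a \<in> I\<close> both sides agree since the \<open>z m\<close> have no such component; along
  the others this is the Riccati equation.\<close>

lemma graph_invariant:
  assumes z: "graph_solution z"
    and k: "k \<in> I"
  shows "\<Sigma>h (u k + z k) = smul (of_real (lam k)) (u k + z k) +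
    (\<Sum>m\<in>I. smul (ip (E (u k + z k)) (u m)) (u m + z m))"
proof (rule onb_eqI[OF u_onb])
  fix a assume a: "a \<in> J"
  let ?v = "u k + z k"
  let ?e = "\<lambda>m. ip (E ?v) (u m)"
  have kJ: "k \<in> J" and IJ: "\<And>m. m \<in> I \<Longrightarrow> m \<in> J" using k I_subset by auto
  show "ip (\<Sigma>h ?v) (u a) =
    ip (smul (of_real (lam k)) ?v + (\<Sum>m\<in>I. smul (?e m) (u m + z m))) (u a)"
  proof (cases "a \<in> I")
    case True
    have "(\<Sum>m\<in>I. ?e m * ip (u m + z m) (u a)) = (\<Sum>m\<in>I. if m = a then ?e a else 0)"
      using z True a IJ by (intro sum.cong) (auto simp: ip_add_left ip_u graph_solution_def dominated_def)
    then have "(\<Sum>m\<in>I. ?e m * ip (u m + z m) (u a)) = ?e a"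
      using True I_finite by simp
    then show ?thesis
      unfolding ip_\<Sigma>h_u[OF a] ip_add_left[of "smul _ _"] ip_sum_left ip_smul_left
      using z k kJ a True by (simp add: ip_add_left[of "u k"] ip_u graph_solution_def dominated_def)
  next
    case False
    have "(\<Sum>m\<in>I. ?e m * ip (u m + z m) (u a)) = (\<Sum>m\<in>I. ip (z m) (u a) * ?e m)"
      using False a IJ by (intro sum.cong) (auto simp: ip_add_left ip_u)
    moreover have "ip (z k) (u a) * (of_real (lam k) - of_real (lam a)) = ?e a - (\<Sum>m\<in>I. ip (z m) (u a) * ?e m)"
      using z k a False lam_neq[OF k, of a] by (auto simp: graph_solution_def graph_step_def)
    moreover have "ip ?v (u a) = ip (z k) (u a)"
      using False a k kJ by (auto simp: ip_add_left ip_u)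
    ultimately show ?thesis
      unfolding ip_\<Sigma>h_u[OF a] ip_add_left[of "smul _ _"] ip_sum_left ip_smul_left
      by (simp add: algebra_simps)
  qed
qed

text \<open>Pairing the invariance relation with \<open>w\<close> gives, for the numbers
  \<open>f k = ip (u k + z k) w\<close>, the system
  \<open>(\<mu> - lam k) * f k = (\<Sum>m\<in>I. ip (E (u k + z k)) (u m) * f m)\<close>. Its right-hand side is small
  relative to the distance of \<open>\<mu>\<close> to \<open>lam k\<close>, which excludes a nonzero solution.\<close>

lemma graph_orthogonal_eigenvector:
  assumes z: "graph_solution z"
    and w: "\<Sigma>h w = smul (of_real \<mu>) w" and j: "j \<in> J - I"
    and far: "\<And>k. k \<in> I \<Longrightarrow> \<bar>lam j - lam k\<bar> / 2 \<le> \<bar>\<mu> - lam k\<bar>" and k: "k \<in> I"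
  shows "ip (u k + z k) w = 0"
proof -
  define f where "f k = ip (u k + z k) w" for k
  define \<Phi> where "\<Phi> = (\<Sum>m\<in>I. sqrt (lam m) * norm (f m))"
  have \<Phi>_nonneg: "0 \<le> \<Phi>"
    unfolding \<Phi>_def using lam_pos_I by (intro sum_nonneg mult_nonneg_nonneg) (auto intro: less_imp_le)
  have est: "sqrt (lam k) * norm (f k) \<le> 5 / 2 * \<Phi> * (x * (lam k / \<bar>lam j - lam k\<bar>))" if k: "k \<in> I" for k
  proof -
    let ?v = "u k + z k"
    have "of_real \<mu> * f k = ip (\<Sigma>h ?v) w"
      using \<Sigma>h_self_adjoint w by (simp add: f_def self_adjoint_def ip_smul_right)
    also have "\<dots> = of_real (lam k) * f k + (\<Sum>m\<in>I. ip (E ?v) (u m) * f m)"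
      unfolding graph_invariant[OF z k]
      by (simp add: ip_add_left[of "smul _ _"] ip_sum_left ip_smul_left f_def)
    finally have "of_real (\<mu> - lam k) * f k = (\<Sum>m\<in>I. ip (E ?v) (u m) * f m)"
      by (simp add: algebra_simps)
    then have "\<bar>\<mu> - lam k\<bar> * norm (f k) = norm (\<Sum>m\<in>I. ip (E ?v) (u m) * f m)"
      by (metis norm_mult norm_of_real)
    also have "\<dots> \<le> (\<Sum>m\<in>I. x * wnorm ?v * (sqrt (lam m) * norm (f m)))"
    proof (rule sum_norm_le)
      fix m assume "m \<in> I"
      then show "norm (ip (E ?v) (u m) * f m) \<le> x * wnorm ?v * (sqrt (lam m) * norm (f m))"
        using mult_right_mono[OF norm_ip_E_u_le[of m ?v] norm_ge_zero[of "f m"]] I_subset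
        by (auto simp: norm_mult mult_ac)
    qed
    also have "\<dots> = x * wnorm ?v * \<Phi>" by (simp add: \<Phi>_def sum_distrib_left)
    also have "\<dots> \<le> x * (5 / 4 * sqrt (lam k)) * \<Phi>"
      using wnorm_graph_le[of 2 z k] z k x_pos \<Phi>_nonneg
      unfolding graph_solution_def by (intro mult_right_mono mult_left_mono) auto
    finally have "\<bar>lam j - lam k\<bar> / 2 * norm (f k) \<le> x * (5 / 4 * sqrt (lam k)) * \<Phi>"
      using mult_right_mono[OF far[OF k] norm_ge_zero[of "f k"]] by linarith
    then have "norm (f k) \<le> 5 / 2 * x * sqrt (lam k) * \<Phi> / \<bar>lam j - lam k\<bar>"
      using lam_neq[OF k j] by (simp add: field_simps)
    then have "sqrt (lam k) * norm (f k) \<le> sqrt (lam k) * (5 / 2 * x * sqrt (lam k) * \<Phi> / \<bar>lam j - lam k\<bar>)"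
      using lam_pos_I[OF k] by (intro mult_left_mono) auto
    also have "\<dots> = 5 / 2 * \<Phi> * (x * ((sqrt (lam k))\<^sup>2 / \<bar>lam j - lam k\<bar>))"
      by (simp add: power2_eq_square)
    finally show ?thesis using lam_pos_I[OF k] by simp
  qed
  \<comment> \<open>The weighted sum of the \<open>norm (f k)\<close> is at most \<open>5 / 16\<close> times itself.\<close>
  have "\<Phi> \<le> (\<Sum>k\<in>I. 5 / 2 * \<Phi> * (x * (lam k / \<bar>lam j - lam k\<bar>)))"
    unfolding \<Phi>_def[symmetric] by (subst \<Phi>_def) (rule sum_mono[OF est])
  also have "\<dots> = 5 / 2 * \<Phi> * (x * (\<Sum>k\<in>I. lam k / \<bar>lam j - lam k\<bar>))"
    by (simp add: sum_distrib_left)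
  also have "\<dots> \<le> 5 / 2 * \<Phi> * (1 / 8)"
    using \<Phi>_nonneg column_rank_le[OF j] by (intro mult_left_mono) auto
  finally have "\<Phi> = 0" using \<Phi>_nonneg by linarith
  then have "sqrt (lam k) * norm (f k) = 0"
    unfolding \<Phi>_def using k I_finite lam_pos_I
    by (subst (asm) sum_nonneg_eq_0_iff) (auto intro!: mult_nonneg_nonneg intro: less_imp_le)
  then show ?thesis using lam_pos_I[OF k] by (simp add: f_def)
qed

text \<open>Otherwise the component \<open>w\<close> of \<open>u k + z k\<close> orthogonal to the range is nonzero. It is orthogonal
  to all \<open>uh j\<close>, so \<open>\<Sigma>h\<close> maps it to 0. In finite dimension there are too many orthonormal vectors;
  in infinite dimension, \<open>w\<close> is an eigenvector whose eigenvalue 0 is far from the \<open>lam k\<close>, hence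
  orthogonal to \<open>u k + z k\<close>, hence to itself.\<close>

lemma graph_in_range:
  assumes z: "graph_solution z"
    and k: "k \<in> I"
  shows "u k + z k = proj_sum smul ip uh I (u k + z k)"
proof (rule ccontr)
  let ?v = "u k + z k"
  define w where "w = ?v - (\<Sum>i\<in>I. smul (ip ?v (uh i)) (uh i))"
  assume "?v \<noteq> proj_sum smul ip uh I ?v"
  then have w0: "w \<noteq> 0" by (simp add: w_def proj_sum_def proj_def)
  have uh_ij: "ip (uh i) (uh j) = (if i = j then 1 else 0)" if "i \<in> J" "j \<in> J" for i j
    using uh_orthonormal that by (simp add: orthonormal_def)
  have w_uh: "ip w (uh j) = 0" if j: "j \<in> J" for j
  proof (cases "j \<in> I")
    case True
    then show ?thesis unfolding w_def
      by (rule ip_residual_orthonormal[OF orthonormal_subset[OF uh_orthonormal I_subset] I_finite])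
  next
    case False
    then have j': "j \<in> J - I" using j by simp
    have "ip ?v (uh j) = 0"
    proof (rule graph_orthogonal_eigenvector[OF z \<Sigma>h_uh[OF j] j' _ k])
      fix i assume "i \<in> I"
      moreover have "\<bar>lam j - lam i\<bar> \<le> \<bar>lamh j - lam i\<bar> + \<bar>lamh j - lam j\<bar>" by linarith
      ultimately show "\<bar>lam j - lam i\<bar> / 2 \<le> \<bar>lamh j - lam i\<bar>"
        using gap_le[OF j'] eigenvalue_compl[OF j'] by fastforce
    qed
    moreover have "ip (smul (ip ?v (uh i)) (uh i)) (uh j) = 0" if "i \<in> I" for i
    proof -
      have "i \<in> J" "i \<noteq> j" using that False I_subset by auto
      then show ?thesis using j by (simp add: ip_smul_left uh_ij)
    qed
    ultimately show ?thesis by (simp add: w_def ip_diff_left ip_sum_left)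
  qed
  have "((\<lambda>i. smul (of_real (lamh i)) (proj smul ip (uh i) w)) has_sum 0) J"
    by (rule has_sum_0) (simp add: proj_def w_uh)
  then have \<Sigma>h_w: "\<Sigma>h w = 0" using \<Sigma>h_spectral has_sum_unique by blast
  show False
  proof (cases p)
    case (enat n)
    have J: "J = {1..n}" by (auto simp: indices_def enat)
    define b where "b i = (if i = 0 then smul (of_real (1 / norm w)) w else uh i)" for i :: nat
    have "ip (b 0) (b 0) = 1"
      using w0 ip_self[of "b 0"] by (simp add: b_def norm_smul norm_divide)
    moreover have "ip (b 0) (b i) = 0" "ip (b i) (b 0) = 0" if "i \<in> {1..n}" for i
      using that w_uh[of i] ip_eq_0_commute[of w "uh i"] J by (auto simp: b_def ip_smul_left ip_smul_right)
    moreover have "ip (b i) (b j) = (if i = j then 1 else 0)" if "i \<in> {1..n}" "j \<in> {1..n}" for i j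
      using that uh_ij J by (auto simp: b_def)
    moreover have "{0..n} = insert 0 {1..n}" by auto
    ultimately have on: "orthonormal ip {0..n} b"
      unfolding orthonormal_def by auto
    obtain c where c: "(\<Sum>i\<in>{0..n}. smul (c i) (b i)) \<noteq> 0"
      "\<And>r. r \<in> {1..n} \<Longrightarrow> ip (\<Sum>i\<in>{0..n}. smul (c i) (b i)) (u r) = 0"
      using orthogonal_combination[OF on, of "{1..n}" u] by auto
    have "(\<Sum>i\<in>{0..n}. smul (c i) (b i)) = 0"
      by (rule onb_eqI[OF u_onb]) (use c(2) J in auto)
    then show False using c(1) by blast
  next
    case infinity
    have J: "J = {1..}" by (auto simp: indices_def infinity)
    \<comment> \<open>Any index beyond \<open>I\<close> serves as comparison: \<open>lam i\<close> is at least \<open>lam i - lam j\<close>.\<close>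
    obtain m where m: "\<And>i. i \<in> I \<Longrightarrow> i < m"
      using I_finite finite_nat_set_iff_bounded by auto
    define j where "j = Suc m"
    have j: "j \<in> J - I" "\<And>i. i \<in> I \<Longrightarrow> i \<le> j"
      using m by (fastforce simp: J j_def)+
    have "ip ?v w = 0"
    proof (rule graph_orthogonal_eigenvector[OF z _ j(1) _ k, where \<mu> = 0])
      show "\<Sigma>h w = smul (of_real 0) w" by (simp add: \<Sigma>h_w)
      fix i assume i: "i \<in> I"
      have "lam j \<le> lam i" using lam_antimono[of i j] j i I_subset by auto
      then show "\<bar>lam j - lam i\<bar> / 2 \<le> \<bar>0 - lam i\<bar>"
        using lam_pos_compl[OF j(1)] by (simp add: abs_if)
    qed
    moreover have "ip (smul (ip ?v (uh i)) (uh i)) w = 0" if "i \<in> I" for i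
      using that w_uh[of i] ip_eq_0_commute[of w "uh i"] I_subset by (auto simp: ip_smul_left)
    ultimately have "ip w w = 0"
      by (subst (1) w_def) (simp add: ip_diff_left ip_sum_left)
    then show False using w0 by (simp add: ip_self)
  qed
qed

text \<open>The error of the best approximation of \<open>u k\<close> in the perturbed range is at most \<open>norm (z k)\<close>, as
  \<open>u k + z k\<close> lies there.\<close>

theorem hs_norm_eigenprojections_le:
  "(hs_norm smul ip (\<lambda>v. proj_sum smul ip uh I v - proj_sum smul ip u I v))\<^sup>2
    \<le> 8 * x\<^sup>2 * (\<Sum>i\<in>I. \<Sum>\<^sub>\<infinity>j\<in>J - I. lam i * lam j / (lam i - lam j)\<^sup>2)"
proof -
  let ?Q = "proj_sum smul ip uh I"
  obtain z where z: "graph_solution z" using graph_fixed_point by blast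
  then have dom: "dominated 2 z" by (simp add: graph_solution_def)
  have uh_I: "orthonormal ip I uh" by (rule orthonormal_subset[OF uh_orthonormal I_subset])
  have "(norm (u k - ?Q (u k)))\<^sup>2 \<le> 4 * (\<Sum>\<^sub>\<infinity>l\<in>J - I. (first_order_size l k)\<^sup>2)" if k: "k \<in> I" for k
  proof -
    have "(norm (u k - ?Q (u k)))\<^sup>2 \<le> (norm (u k - ?Q (u k + z k)))\<^sup>2"
      unfolding proj_sum_def proj_def
      using norm_diff_lincomb_orthonormal[OF uh_I I_finite, of "u k" "\<lambda>i. ip (u k + z k) (uh i)"]
      by (simp add: sum_nonneg)
    also have "u k - ?Q (u k + z k) = - z k"
      using graph_in_range[OF z k] by (simp add: algebra_simps)
    also have "(norm (- z k))\<^sup>2 \<le> 4 * (\<Sum>\<^sub>\<infinity>l\<in>J - I. (first_order_size l k)\<^sup>2)"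
      using dominated_norm_sq_le[OF dom k] by simp
    finally show ?thesis .
  qed
  then have "2 * (\<Sum>k\<in>I. (norm (u k - ?Q (u k)))\<^sup>2) \<le> 2 * (\<Sum>k\<in>I. 4 * (\<Sum>\<^sub>\<infinity>l\<in>J - I. (first_order_size l k)\<^sup>2))"
    by (intro mult_left_mono sum_mono) auto
  also have "\<dots> = 8 * (\<Sum>k\<in>I. \<Sum>\<^sub>\<infinity>l\<in>J - I. (first_order_size l k)\<^sup>2)"
    by (simp add: sum_distrib_left)
  also have "(\<Sum>k\<in>I. \<Sum>\<^sub>\<infinity>l\<in>J - I. (first_order_size l k)\<^sup>2)
      = (\<Sum>k\<in>I. \<Sum>\<^sub>\<infinity>l\<in>J - I. x\<^sup>2 * (lam k * lam l / (lam k - lam l)\<^sup>2))"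
    by (intro sum.cong refl infsum_cong) (rule first_order_size_sq)
  also have "\<dots> = x\<^sup>2 * (\<Sum>i\<in>I. \<Sum>\<^sub>\<infinity>j\<in>J - I. lam i * lam j / (lam i - lam j)\<^sup>2)"
    unfolding sum_distrib_left by (intro sum.cong refl infsum_cmult_right')
  finally show ?thesis
    using hs_norm_proj_sum_diff_le[OF u_onb I_finite I_subset uh_I] by (simp add: mult.assoc)
qed

end

section \<open>The relative rank\<close>

lemma sum_le_infsum_ennreal:
  fixes f :: "'i \<Rightarrow> ennreal"
  assumes "finite F" "F \<subseteq> A"
  shows "sum f F \<le> infsum f A"
  unfolding nonneg_infsum_complete[of A f, OF zero_le] using assms by (intro SUP_upper) auto

lemma inverse_antimono_ennreal: "a \<le> b \<Longrightarrow> inverse b \<le> inverse (a :: ennreal)"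
  including ennreal.lifting by transfer (rule ereal_inverse_antimono)

definition spectral_gap :: "(nat \<Rightarrow> real) \<Rightarrow> nat set \<Rightarrow> nat \<Rightarrow> real"
  where "spectral_gap lam I j = Min ((\<lambda>i. \<bar>lam j - lam i\<bar>) ` I)"

lemma spectral_gap_attained:
  assumes "finite I" "I \<noteq> {}"
  shows "\<exists>i\<in>I. spectral_gap lam I j = \<bar>lam j - lam i\<bar>"
proof -
  have "Min ((\<lambda>i. \<bar>lam j - lam i\<bar>) ` I) \<in> (\<lambda>i. \<bar>lam j - lam i\<bar>) ` I"
    using assms by (intro Min_in) auto
  then show ?thesis unfolding spectral_gap_def image_iff .
qed

lemma spectral_gap_le: "finite I \<Longrightarrow> i \<in> I \<Longrightarrow> spectral_gap lam I j \<le> \<bar>lam j - lam i\<bar>"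
  by (simp add: spectral_gap_def)

text \<open>A finite bound excludes vanishing denominators, since a positive number divided by 0 is
  infinite. After that all finite partial sums are real.\<close>

lemma rel_rank_boundD:
  assumes I: "finite I" "I \<noteq> {}" "I \<subseteq> indices p"
    and pos: "\<And>i. i \<in> indices p \<Longrightarrow> 0 < lam i"
    and le: "rel_rank p lam I \<le> ennreal c" and c: "0 \<le> c"
  defines "g \<equiv> spectral_gap lam I"
  shows "\<And>j. j \<in> indices p - I \<Longrightarrow> 0 < g j"
    and "(\<lambda>l. lam l / g l) summable_on indices p - I"
    and "\<And>j. j \<in> indices p - I \<Longrightarrow>
      (\<Sum>i\<in>I. lam i / \<bar>lam i - lam j\<bar>) + (\<Sum>\<^sub>\<infinity>l\<in>indices p - I. lam l / g l) \<le> c"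
proof -
  let ?K = "indices p - I"
  have inf: "(INF i\<in>I. ennreal \<bar>lam l - lam i\<bar>) = ennreal (g l)" for l
  proof (rule antisym)
    obtain i where "i \<in> I" "g l = \<bar>lam l - lam i\<bar>"
      using spectral_gap_attained[OF I(1,2)] unfolding g_def by metis
    then show "(INF i\<in>I. ennreal \<bar>lam l - lam i\<bar>) \<le> ennreal (g l)"
      by (auto intro: INF_lower)
    show "ennreal (g l) \<le> (INF i\<in>I. ennreal \<bar>lam l - lam i\<bar>)"
      using spectral_gap_le[OF I(1)] unfolding g_def by (intro INF_greatest ennreal_leI)
  qed
  have parts: "(\<Sum>i\<in>I. ennreal (lam i) / ennreal \<bar>lam i - lam j\<bar>)
      + (\<Sum>l\<in>F. ennreal (lam l) / ennreal (g l)) \<le> ennreal c"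
    if j: "j \<in> ?K" and F: "finite F" "F \<subseteq> ?K" for j F
  proof -
    have "(\<Sum>i\<in>I. ennreal (lam i) / ennreal \<bar>lam i - lam j\<bar>)
      \<le> (\<Sum>\<^sub>\<infinity>i\<in>I. ennreal (lam i) / (INF j\<in>?K. ennreal \<bar>lam i - lam j\<bar>))"
      unfolding infsum_finite[OF I(1)]
      unfolding divide_ennreal_def
      by (intro sum_mono mult_left_mono inverse_antimono_ennreal INF_lower j zero_le)
    moreover have "(\<Sum>l\<in>F. ennreal (lam l) / ennreal (g l))
      \<le> (\<Sum>\<^sub>\<infinity>l\<in>?K. ennreal (lam l) / (INF i\<in>I. ennreal \<bar>lam l - lam i\<bar>))"
      unfolding inf by (rule sum_le_infsum_ennreal[OF F])
    ultimately show ?thesis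
      using le unfolding rel_rank_def by (meson add_mono order_trans)
  qed
  show gap_pos: "0 < g j" if j: "j \<in> ?K" for j
  proof (rule ccontr)
    assume "\<not> 0 < g j"
    then have "ennreal (g j) = 0" by (simp add: ennreal_neg)
    moreover have "ennreal (lam j) \<noteq> 0" using pos[of j] j by (simp add: ennreal_eq_0_iff)
    ultimately have "(\<Sum>l\<in>{j}. ennreal (lam l) / ennreal (g l)) = top" by (simp add: ennreal_divide_zero)
    then have "top \<le> ennreal c" using parts[OF j, of "{j}"] j by simp
    then show False by (simp add: top_unique)
  qed
  have real_parts: "(\<Sum>i\<in>I. lam i / \<bar>lam i - lam j\<bar>) + (\<Sum>l\<in>F. lam l / g l) \<le> c"
    if j: "j \<in> ?K" and F: "finite F" "F \<subseteq> ?K" for j F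
  proof -
    have nn1: "0 \<le> lam i / \<bar>lam i - lam j\<bar>" if "i \<in> I" for i
      using pos[of i] that I(3) by (intro divide_nonneg_nonneg) auto
    have nn2: "0 \<le> lam l / g l" if "l \<in> F" for l
      using pos[of l] gap_pos[of l] that F(2) by (intro divide_nonneg_nonneg) auto
    have 1: "ennreal (lam i) / ennreal \<bar>lam i - lam j\<bar> = ennreal (lam i / \<bar>lam i - lam j\<bar>)"
      if i: "i \<in> I" for i
    proof (rule divide_ennreal)
      show "0 \<le> lam i" using pos[of i] i I(3) by auto
      show "0 < \<bar>lam i - lam j\<bar>"
        using gap_pos[OF j] spectral_gap_le[OF I(1) i, of lam j] by (simp add: g_def)
    qed
    have 2: "ennreal (lam l) / ennreal (g l) = ennreal (lam l / g l)" if "l \<in> F" for l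
      using pos[of l] gap_pos[of l] that F(2) by (intro divide_ennreal) auto
    have "ennreal ((\<Sum>i\<in>I. lam i / \<bar>lam i - lam j\<bar>) + (\<Sum>l\<in>F. lam l / g l)) =
      (\<Sum>i\<in>I. ennreal (lam i) / ennreal \<bar>lam i - lam j\<bar>)
      + (\<Sum>l\<in>F. ennreal (lam l) / ennreal (g l))"
      using nn1 nn2 by (simp add: 1 2 ennreal_plus sum_nonneg sum_ennreal del: ennreal_plus[symmetric])
    also have "\<dots> \<le> ennreal c" by (rule parts[OF j F])
    finally show ?thesis unfolding ennreal_le_iff[OF c] .
  qed
  have I_nonneg: "0 \<le> (\<Sum>i\<in>I. lam i / \<bar>lam i - lam j\<bar>)" for j
    using pos I(3) by (intro sum_nonneg divide_nonneg_nonneg) (auto intro: less_imp_le)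
  show summ: "(\<lambda>l. lam l / g l) summable_on ?K"
  proof (cases "?K = {}")
    case True
    then show ?thesis by (simp only: summable_on_empty)
  next
    case False
    then obtain j where j: "j \<in> ?K" by blast
    have "(\<Sum>l\<in>F. lam l / g l) \<le> c" if "finite F" "F \<subseteq> ?K" for F
      using real_parts[OF j that] I_nonneg[of j] by linarith
    then show ?thesis
      using pos gap_pos
      by (intro nonneg_bdd_above_summable_on)
         (auto intro!: bdd_aboveI[where M = c] divide_nonneg_nonneg intro: less_imp_le)
  qed
  show "(\<Sum>i\<in>I. lam i / \<bar>lam i - lam j\<bar>) + (\<Sum>\<^sub>\<infinity>l\<in>?K. lam l / g l) \<le> c"
    if j: "j \<in> ?K" for j
  proof -
    have "(\<Sum>\<^sub>\<infinity>l\<in>?K. lam l / g l) \<le> c - (\<Sum>i\<in>I. lam i / \<bar>lam i - lam j\<bar>)"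
      using real_parts[OF j] by (intro infsum_le_finite_sums summ) (simp add: le_diff_eq add.commute)
    then show ?thesis by linarith
  qed
qed

theorem theorem1:
  fixes smul :: "'k::rc_field \<Rightarrow> 'a::{banach, second_countable_topology} \<Rightarrow> 'a"
    and ip :: "'a \<Rightarrow> 'a \<Rightarrow> 'k"
    and p :: enat
    and \<Sigma> \<Sigma>h E :: "'a \<Rightarrow> 'a"
    and lam lamh :: "nat \<Rightarrow> real"
    and u uh :: "nat \<Rightarrow> 'a"
    and I :: "nat set"
    and x :: real
  assumes "hilbert_space smul ip"
    and "1 \<le> p"
    and "trace_class smul ip \<Sigma>"
    and "self_adjoint ip \<Sigma>"
    and "strictly_positive smul ip \<Sigma>"
    and "onb smul ip (indices p) u"
    and "\<And>i. i \<in> indices p \<Longrightarrow> \<Sigma> (u i) = smul (of_real (lam i)) (u i)"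
    and "\<And>i j. i \<in> indices p \<Longrightarrow> j \<in> indices p \<Longrightarrow> i \<le> j \<Longrightarrow> lam j \<le> lam i"
    and "\<And>i. i \<in> indices p \<Longrightarrow> 0 < lam i"
    and "lam summable_on indices p"
    and "compact_op smul \<Sigma>h"
    and "self_adjoint ip \<Sigma>h"
    and "positive_op ip \<Sigma>h"
    and "orthonormal ip (indices p) uh"
    and "\<And>v. ((\<lambda>i. smul (of_real (lamh i)) (proj smul ip (uh i) v)) has_sum \<Sigma>h v) (indices p)"
    and "\<And>i j. i \<in> indices p \<Longrightarrow> j \<in> indices p \<Longrightarrow> i \<le> j \<Longrightarrow> lamh j \<le> lamh i"
    and "\<And>i. i \<in> indices p \<Longrightarrow> 0 \<le> lamh i"
    and "E = (\<lambda>v. \<Sigma>h v - \<Sigma> v)"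
    and "finite I" and "I \<subseteq> indices p"
    and "0 < x"
    and "\<And>i j. i \<in> indices p \<Longrightarrow> j \<in> indices p \<Longrightarrow>
          hs_norm smul ip (proj smul ip (u i) \<circ> E \<circ> proj smul ip (u j)) \<le> x * sqrt (lam i * lam j)"
    and "rel_rank p lam I \<le> ennreal (1 / (8 * x))"
  shows "(hs_norm smul ip (\<lambda>v. proj_sum smul ip uh I v - proj_sum smul ip u I v))\<^sup>2
    \<le> 16 * x\<^sup>2 * (\<Sum>i\<in>I. \<Sum>\<^sub>\<infinity>j\<in>indices p - I. lam i * lam j / (lam i - lam j)\<^sup>2)"
proof (cases "I = {}")
  case True
  then show ?thesis by (simp add: proj_sum_def hs_norm_def)
next
  case False
  interpret hilbert_space smul ip by (rule assms(1))
  have ops: "bounded_op smul \<Sigma>" "bounded_op smul \<Sigma>h"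
    using assms(3,11) by (auto simp: trace_class_def compact_op_def)
  have E_smul: "E (smul c v) = smul c (E v)" for c v
    using ops unfolding assms(18) bounded_op_def
    by (simp add: Vector_Spaces.linear_iff scale_right_diff_distrib)
  note rank = rel_rank_boundD[OF assms(19) False assms(20,9,23)]
  interpret separated_perturbation smul ip p \<Sigma> \<Sigma>h lam lamh u uh x I "spectral_gap lam I"
  proof unfold_locales
    show "norm (ip (\<Sigma>h (u j) - \<Sigma> (u j)) (u i)) \<le> x * sqrt (lam i * lam j)"
      if "i \<in> indices p" "j \<in> indices p" for i j
      using assms(22)[OF that] hs_norm_proj_comp_proj[OF assms(6) that E_smul]
      unfolding assms(18) by simp
  qed (use assms ops rank spectral_gap_attained[OF assms(19) False] spectral_gap_le[OF assms(19)]
       in \<open>auto simp: less_imp_le\<close>)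
  have "0 \<le> (\<Sum>i\<in>I. \<Sum>\<^sub>\<infinity>j\<in>indices p - I. lam i * lam j / (lam i - lam j)\<^sup>2)"
    using lam_pos_I lam_pos_compl
    by (intro sum_nonneg infsum_nonneg divide_nonneg_nonneg mult_nonneg_nonneg)
       (auto intro: less_imp_le)
  then have "8 * x\<^sup>2 * (\<Sum>i\<in>I. \<Sum>\<^sub>\<infinity>j\<in>indices p - I. lam i * lam j / (lam i - lam j)\<^sup>2)
    \<le> 16 * x\<^sup>2 * (\<Sum>i\<in>I. \<Sum>\<^sub>\<infinity>j\<in>indices p - I. lam i * lam j / (lam i - lam j)\<^sup>2)"
    by (intro mult_right_mono) auto
  then show ?thesis using hs_norm_eigenprojections_le by linarith
qed

end
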